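(* Let $G$ be a totally disconnected, locally compact (Hausdorff) topological group with neutral element $e$, and let $\alpha\colon G\to G$ be a continuous endomorphism. Then $$\Omega:=\operatorname{con}(\alpha)\operatorname{lev}(\alpha)\operatorname{con}^-(\alpha)=\{xyz\colon x\in\operatorname{con}(\alpha),\,y\in\operatorname{lev}(\alpha),\,z\in\operatorname{con}^-(\alpha)\}$$ is an open neighbourhood of $e$ in $G$ such that $\alpha(\Omega)\subseteq\Omega$, and the map $$\operatorname{par}(\alpha)\times\operatorname{par}^-(\alpha)\to\Omega,\quad (x,y)\mapsto xy$$ is continuous, surjective, and open (where $\operatorname{par}(\alpha)$, $\operatorname{par}^-(\alpha)$ and $\Omega$ carry the topologies induced by $G$).
   Context: For $x\in G$, an $\alpha$-regressive trajectory for $x$ is a sequence $(x_{-n})_{n\in\mathbb{N}_0}$ in $G$ with $x_0=x$ and $\alpha(x_{-n})=x_{-n+1}$ for all $n\in\mathbb{N}=\{1,2,\ldots\}$. Define the following subgroups of $G$: - $\operatorname{con}(\alpha)$: all $x\in G$ with $\alpha^n(x)\to e$ as $n\to\infty$; - $\operatorname{con}^-(\alpha)$: all $x\in G$ having an $\alpha$-regressive trajectory $(x_{-n})_{n\in\mathbb{N}_0}$ with $x_{-n}\to e$ as $n\to\infty$; - $\operatorname{par}(\alpha)$: all $x\in G$ such that $\{\alpha^n(x)\colon n\in\mathbb{N}_0\}$ is relatively compact in $G$; - $\operatorname{par}^-(\alpha)$: all $x\in G$ having an $\alpha$-regressive trajectory $(x_{-n})_{n\in\mathbb{N}_0}$ such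 that $\{x_{-n}\colon n\in\mathbb{N}_0\}$ is relatively compact in $G$; - $\operatorname{lev}(\alpha):=\operatorname{par}(\alpha)\cap\operatorname{par}^-(\alpha)$. *)

theory Defs
  imports "HOL-Analysis.Analysis"
begin

text \<open>
  Topological groups are rendered by the library class topological_group_add. That class extends
  group_add and hence does not assume commutativity: the product \<open>x y\<close> and the neutral
  element \<open>e\<close> of a general topological group are written \<open>x + y\<close> and \<open>0\<close>.
  The class does not imply any separation axiom, so the Hausdorff property is requested
  separately through t2_space.
\<close>

definition totally_disconnected :: "'a::topological_space set \<Rightarrow> bool" where
  "totally_disconnected S \<longleftrightarrow> (\<forall>x\<in>S. connected_component_set S x = {x})"

definition relatively_compact :: "'a::topological_space set \<Rightarrow> bool" where
  "relatively_compact S \<longleftrightarrow> compact (closure S)"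

definition continuous_endomorphism :: "('a::topological_group_add \<Rightarrow> 'a) \<Rightarrow> bool" where
  "continuous_endomorphism \<alpha> \<longleftrightarrow>
     continuous_on UNIV \<alpha> \<and> (\<forall>x y. \<alpha> (x + y) = \<alpha> x + \<alpha> y)"

text \<open>The value \<open>s n\<close> stands for the member of the trajectory with index \<open>-n\<close>.\<close>

definition regressive_trajectory :: "('a \<Rightarrow> 'a) \<Rightarrow> 'a \<Rightarrow> (nat \<Rightarrow> 'a) \<Rightarrow> bool" where
  "regressive_trajectory \<alpha> x s \<longleftrightarrow> s 0 = x \<and> (\<forall>n. \<alpha> (s (Suc n)) = s n)"

definition con :: "('a::topological_group_add \<Rightarrow> 'a) \<Rightarrow> 'a set" where
  "con \<alpha> = {x. (\<lambda>n. (\<alpha> ^^ n) x) \<longlonglongrightarrow> 0}"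

definition con_minus :: "('a::topological_group_add \<Rightarrow> 'a) \<Rightarrow> 'a set" where
  "con_minus \<alpha> = {x. \<exists>s. regressive_trajectory \<alpha> x s \<and> s \<longlonglongrightarrow> 0}"

definition par :: "('a::topological_group_add \<Rightarrow> 'a) \<Rightarrow> 'a set" where
  "par \<alpha> = {x. relatively_compact (range (\<lambda>n. (\<alpha> ^^ n) x))}"

definition par_minus :: "('a::topological_group_add \<Rightarrow> 'a) \<Rightarrow> 'a set" where
  "par_minus \<alpha> = {x. \<exists>s. regressive_trajectory \<alpha> x s \<and> relatively_compact (range s)}"

definition lev :: "('a::topological_group_add \<Rightarrow> 'a) \<Rightarrow> 'a set" where
  "lev \<alpha> = par \<alpha> \<inter> par_minus \<alpha>"

definition Omega :: "('a::topological_group_add \<Rightarrow> 'a) \<Rightarrow> 'a set" where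
  "Omega \<alpha> = {x + y + z | x y z. x \<in> con \<alpha> \<and> y \<in> lev \<alpha> \<and> z \<in> con_minus \<alpha>}"

end

theory Submission
  imports Defs
begin

text \<open>
  For a compact open subgroup \<open>V\<close>, let \<open>V\<^sub>-\<close> and \<open>V\<^sub>+\<close> consist of the starting points of
  forward orbits and of regressive trajectories inside \<open>V\<close>. A compactness argument in the style of
  Willis's tidying procedure shows that \<open>V\<^sub>- + V\<^sub>+\<close> is a neighbourhood of \<open>0\<close>. Since
  \<open>V\<^sub>- \<subseteq> par \<alpha>\<close> and \<open>V\<^sub>+ \<subseteq> par_minus \<alpha>\<close>, the sum of these two subgroups is open and so is the
  addition map onto it.

  It remains to see that \<open>par \<alpha> = con \<alpha> + lev \<alpha>\<close> and \<open>par_minus \<alpha> = lev \<alpha> + con_minus \<alpha>\<close>. Both follow by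
  treating \<open>\<alpha>\<close> as a closed relation \<open>R\<close>, the graph or its converse: every bounded \<open>R\<close>-trajectory \<open>x\<close> is
  asymptotic to a bounded bi-infinite one. One considers pairs of a bi-infinite trajectory \<open>y\<close> and a compact
  stable subgroup \<open>K\<close> such that \<open>- y + x\<close> converges to \<open>K\<close>. The factorization relative to \<open>K\<close> shrinks \<open>K\<close> into
  any given compact open subgroup, so that a minimal pair, which exists by Zorn's lemma even when the
  group is not metrizable, has \<open>K = 0\<close>.
\<close>

section \<open>Compactness\<close>

text \<open>Directedness replaces each finite intersection by a single member of the family, so it
  suffices that every member meets \<open>C\<close>. Infinite trajectories are assembled from finite
  pieces in this way.\<close>

lemma compact_directed_Inter:
  assumes "compact C" "I \<noteq> {}"
    and cl: "\<And>i. i \<in> I \<Longrightarrow> closed (A i)"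
    and ne: "\<And>i. i \<in> I \<Longrightarrow> C \<inter> A i \<noteq> {}"
    and dir: "\<And>i j. i \<in> I \<Longrightarrow> j \<in> I \<Longrightarrow> \<exists>k\<in>I. A k \<subseteq> A i \<inter> A j"
  shows "\<exists>x\<in>C. \<forall>i\<in>I. x \<in> A i"
proof -
  have lower: "\<exists>k\<in>I. A k \<subseteq> (\<Inter>i\<in>J. A i)" if "finite J" "J \<subseteq> I" for J
    using that
  proof (induction J rule: finite_induct)
    case empty
    then show ?case using \<open>I \<noteq> {}\<close> by auto
  next
    case (insert i J)
    then obtain k where k: "k \<in> I" "A k \<subseteq> (\<Inter>i\<in>J. A i)" by auto
    obtain l where "l \<in> I" "A l \<subseteq> A i \<inter> A k" using dir[of i k] insert k by auto
    then show ?case using k by (intro bexI[of _ l]) auto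
  qed
  have "C \<inter> (\<Inter>i\<in>I. A i) \<noteq> {}"
  proof (rule compact_imp_fip_image[OF \<open>compact C\<close> cl])
    fix J assume "finite J" "J \<subseteq> I"
    then obtain k where "k \<in> I" "A k \<subseteq> (\<Inter>i\<in>J. A i)" using lower by blast
    then show "C \<inter> (\<Inter>i\<in>J. A i) \<noteq> {}" using ne[of k] by blast
  qed
  then show ?thesis by auto
qed

text \<open>Tychonoff's theorem for the function type. With \<open>X\<close> constant, the sequences
  in a compact set form a compact space.\<close>

lemma compact_fun_box:
  fixes X :: "'i \<Rightarrow> 'b::topological_space set"
  assumes "\<And>i. compact (X i)"
  shows "compact {h. \<forall>i. h i \<in> X i}"
proof -
  have "compactin (product_topology (\<lambda>i. euclidean) UNIV) (PiE UNIV X)"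
    unfolding compactin_PiE using assms by auto
  then show ?thesis by (simp add: euclidean_product_topology PiE_def Pi_def)
qed

lemma closed_vimage_UNIV:
  assumes "closed S" "continuous_on UNIV f"
  shows "closed {x. f x \<in> S}"
  using closed_vimage[OF assms] by (simp add: vimage_def)

lemma open_vimage_UNIV:
  assumes "open S" "continuous_on UNIV f"
  shows "open {x. f x \<in> S}"
  using open_vimage[OF assms] by (simp add: vimage_def)

section \<open>Sums of subsets\<close>

definition sumset :: "'a::plus set \<Rightarrow> 'a set \<Rightarrow> 'a set" where
  "sumset A B = {a + b |a b. a \<in> A \<and> b \<in> B}"

lemma sumsetI: "a \<in> A \<Longrightarrow> b \<in> B \<Longrightarrow> a + b \<in> sumset A B"
  by (auto simp: sumset_def)

lemma sumsetE:
  assumes "x \<in> sumset A B"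
  obtains a b where "a \<in> A" "b \<in> B" "x = a + b"
  using assms by (auto simp: sumset_def)

lemma sumset_mono: "A \<subseteq> A' \<Longrightarrow> B \<subseteq> B' \<Longrightarrow> sumset A B \<subseteq> sumset A' B'"
  by (auto simp: sumset_def)

lemma compact_sumset:
  fixes A B :: "'a::topological_group_add set"
  assumes "compact A" "compact B"
  shows "compact (sumset A B)"
proof -
  have "compact ((\<lambda>p. fst p + snd p) ` (A \<times> B))"
    by (intro compact_continuous_image compact_Times assms continuous_intros)
  also have "(\<lambda>p. fst p + snd p) ` (A \<times> B) = sumset A B" by (force simp: sumset_def)
  finally show ?thesis .
qed

lemma open_sumset:
  fixes V :: "'a::topological_group_add set"
  assumes "open V"
  shows "open (sumset U V)"
proof -
  have "sumset U V = (\<Union>u\<in>U. {x. - u + x \<in> V})"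
  proof (intro set_eqI iffI)
    fix x assume "x \<in> (\<Union>u\<in>U. {x. - u + x \<in> V})"
    then obtain u where "u \<in> U" "- u + x \<in> V" "x = u + (- u + x)"
      by (auto simp: add.assoc[symmetric])
    then show "x \<in> sumset U V" by (metis sumsetI)
  next
    fix x assume "x \<in> sumset U V"
    then obtain u v where "u \<in> U" "v \<in> V" "x = u + v" by (rule sumsetE)
    then show "x \<in> (\<Union>u\<in>U. {x. - u + x \<in> V})"
      by (intro UN_I[of u]) (auto simp: add.assoc[symmetric])
  qed
  then show ?thesis
    by (auto intro!: open_UN open_vimage_UNIV assms continuous_intros)
qed

section \<open>Compact open subgroups\<close>

definition is_subgroup :: "'a::group_add set \<Rightarrow> bool" where
  "is_subgroup H \<longleftrightarrow> 0 \<in> H \<and> (\<forall>x\<in>H. \<forall>y\<in>H. x + y \<in> H) \<and> (\<forall>x\<in>H. - x \<in> H)"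

lemma is_subgroupD:
  assumes "is_subgroup H"
  shows "0 \<in> H" "x \<in> H \<Longrightarrow> y \<in> H \<Longrightarrow> x + y \<in> H" "x \<in> H \<Longrightarrow> - x \<in> H"
  using assms by (auto simp: is_subgroup_def)

lemma is_subgroup_UNIV: "is_subgroup UNIV"
  by (simp add: is_subgroup_def)

lemma is_subgroup_Int: "is_subgroup A \<Longrightarrow> is_subgroup B \<Longrightarrow> is_subgroup (A \<inter> B)"
  by (auto simp: is_subgroup_def)

lemma is_subgroup_converse:
  assumes "is_subgroup R"
  shows "is_subgroup (R\<inverse>)"
proof -
  have "(a + a', b + b') \<in> R" if "(a, b) \<in> R" "(a', b') \<in> R" for a b a' b'
    using is_subgroupD(2)[OF assms that] by simp
  moreover have "(- a, - b) \<in> R" if "(a, b) \<in> R" for a b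
    using is_subgroupD(3)[OF assms that] by simp
  moreover have "(0, 0) \<in> R" using is_subgroupD(1)[OF assms] by (simp add: zero_prod_def)
  ultimately show ?thesis by (auto simp: is_subgroup_def zero_prod_def)
qed

text \<open>Since the component of \<open>0\<close> is trivial, \<open>0\<close> has a compact open
  neighbourhood inside \<open>N\<close>. The elements whose right translation maps this
  neighbourhood onto itself form the desired subgroup.\<close>

theorem van_Dantzig:
  fixes N :: "'a::{topological_group_add, t2_space} set"
  assumes lc: "locally_compact_space (euclidean :: 'a topology)"
    and td: "totally_disconnected (UNIV :: 'a set)"
    and "open N" "0 \<in> N"
  obtains H where "compact H" "open H" "is_subgroup H" "H \<subseteq> N"
proof -
  have "\<exists>Q C. openin euclidean Q \<and> compactin euclidean C \<and> (0::'a) \<in> Q \<and> Q \<subseteq> C"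
    by (rule bspec[OF lc[unfolded locally_compact_space_def], rule_format]) simp
  then obtain Q C where QC: "open Q" "compact C" "(0::'a) \<in> Q" "Q \<subseteq> C"
    unfolding compactin_euclidean_iff open_openin[symmetric] by (elim exE conjE)
  have "connected_component_of_set euclidean (0::'a) = {0}"
    using td unfolding totally_disconnected_def connected_component_def connected_component_of_def
    by simp
  then have comp: "{0::'a} \<in> connected_components_of euclidean"
    unfolding connected_components_of_def by (intro image_eqI[of _ _ 0]) simp_all
  \<comment> \<open>The compact component \<open>{0}\<close> is cut off inside
    \<open>N \<inter> Q\<close> by a partition of the whole space into two open sets, which makes
    \<open>U\<close> clopen.\<close>
  obtain U U' where U: "open U" "open U'" "disjnt U U'" "U \<union> U' = UNIV" "0 \<in> U" "U \<subseteq> N \<inter> Q"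
  proof (rule wilder_locally_compact_component_thm[OF lc _ comp, of "N \<inter> Q"])
    show "openin euclidean (N \<inter> Q)" using \<open>open N\<close> QC by (simp add: open_Int)
    show "Hausdorff_space (euclidean :: 'a topology)"
      unfolding Hausdorff_space_def disjnt_def using hausdorff by (metis open_openin)
  qed (use QC \<open>0 \<in> N\<close> in simp_all)
  have "closed U"
  proof -
    have "U = - U'" using U by (auto simp: disjnt_iff)
    then show ?thesis using U by auto
  qed
  then have "compact U"
    using QC U by (metis Int_absorb1 compact_Int_closed inf.boundedE order.trans)
  \<comment> \<open>Equivalently \<open>U + g = U\<close>. Asking for both signs makes
    \<open>H\<close> closed under inverses, and \<open>0 \<in> U\<close> gives
    \<open>H \<subseteq> U\<close>.\<close>
  define H where "H = {g. \<forall>u\<in>U. u + g \<in> U \<and> u - g \<in> U}"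
  have "H = (\<Inter>u\<in>U. {g. u + g \<in> U} \<inter> {g. u - g \<in> U})" by (auto simp: H_def)
  then have "closed H"
    by (auto intro!: closed_INT closed_Int closed_vimage_UNIV \<open>closed U\<close> continuous_intros)
  have "H \<subseteq> U" using U by (force simp: H_def)
  have "compact H"
    using \<open>H \<subseteq> U\<close> \<open>compact U\<close> \<open>closed H\<close> by (metis Int_absorb1 compact_Int_closed)
  moreover have "open H"
  proof (subst open_subopen, intro ballI)
    fix g assume g: "g \<in> H"
    \<comment> \<open>Compactness of \<open>U\<close> lets one neighbourhood of \<open>g\<close>
      serve all \<open>u \<in> U\<close> at once.\<close>
    let ?W = "{p. snd p + fst p \<in> U} \<inter> {p. snd p - fst p \<in> U}"
    have "open ?W"
      by (intro open_Int open_vimage_UNIV U continuous_intros)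
    moreover have "{g} \<times> U \<subseteq> ?W" using g by (auto simp: H_def)
    ultimately have "\<exists>X. g \<in> X \<and> open X \<and> X \<times> U \<subseteq> ?W"
      by (rule Elementary_Topology.tube_lemma[OF \<open>compact U\<close>])
    then obtain X where X: "g \<in> X" "open X" "X \<times> U \<subseteq> ?W" by (elim exE conjE)
    have "X \<subseteq> H"
    proof
      fix x assume "x \<in> X"
      then have "(x, u) \<in> ?W" if "u \<in> U" for u using X(3) that by blast
      then show "x \<in> H" by (simp add: H_def)
    qed
    then show "\<exists>T. open T \<and> g \<in> T \<and> T \<subseteq> H" using X by blast
  qed
  moreover have "is_subgroup H"
    unfolding is_subgroup_def
  proof (intro conjI ballI)
    fix x y assume xy: "x \<in> H" "y \<in> H"
    have "u + (x + y) \<in> U \<and> u - (x + y) \<in> U" if "u \<in> U" for u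
    proof -
      have "u + x + y \<in> U" "u - y - x \<in> U" using xy that by (auto simp: H_def)
      moreover have "u - (x + y) = u - y - x"
        by (simp only: diff_conv_add_uminus minus_add add.assoc)
      ultimately show ?thesis by (simp add: add.assoc)
    qed
    then show "x + y \<in> H" by (simp add: H_def)
  qed (auto simp: H_def)
  ultimately show ?thesis using that \<open>H \<subseteq> U\<close> U by blast
qed

section \<open>Trajectories of a closed relation\<close>

text \<open>A relation in place of a map treats both directions of time alike: the graph of
  \<open>\<alpha>\<close> gives forward orbits, its converse gives regressive trajectories.\<close>

definition traj :: "('a \<times> 'a) set \<Rightarrow> (nat \<Rightarrow> 'a) set" where
  "traj R = {s. \<forall>n. (s n, s (Suc n)) \<in> R}"

definition bitraj :: "('a \<times> 'a) set \<Rightarrow> (int \<Rightarrow> 'a) set" where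
  "bitraj R = {s. \<forall>i. (s i, s (i + 1)) \<in> R}"

definition fwd :: "('a \<times> 'a) set \<Rightarrow> 'a set \<Rightarrow> 'a set" where
  "fwd R A = {s 0 |s. s \<in> traj R \<and> range s \<subseteq> A}"

text \<open>This is the stable core of \<open>A\<close>: the largest \<open>K \<subseteq> A\<close>
  with \<open>K \<subseteq> bicore R K\<close>.\<close>

definition bicore :: "('a \<times> 'a) set \<Rightarrow> 'a set \<Rightarrow> 'a set" where
  "bicore R A = {s 0 |s. s \<in> bitraj R \<and> range s \<subseteq> A}"

lemma fwdE:
  assumes "x \<in> fwd R A"
  obtains s where "s \<in> traj R" "range s \<subseteq> A" "s 0 = x"
  using assms by (auto simp: fwd_def)

lemma bicoreE:
  assumes "x \<in> bicore R A"
  obtains s where "s \<in> bitraj R" "range s \<subseteq> A" "s 0 = x"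
  using assms by (auto simp: bicore_def)

section \<open>Pointwise operations, shifts and gluing of trajectories\<close>

lemma traj_add:
  assumes "is_subgroup R" "s \<in> traj R" "t \<in> traj R"
  shows "(\<lambda>n. s n + t n) \<in> traj R"
  using assms is_subgroupD(2)[OF assms(1), of "(_, _)" "(_, _)"] by (auto simp: traj_def)

lemma traj_uminus:
  assumes "is_subgroup R" "s \<in> traj R"
  shows "(\<lambda>n. - s n) \<in> traj R"
  using assms is_subgroupD(3)[OF assms(1), of "(_, _)"] by (auto simp: traj_def)

lemma bitraj_add:
  assumes "is_subgroup R" "s \<in> bitraj R" "t \<in> bitraj R"
  shows "(\<lambda>n. s n + t n) \<in> bitraj R"
  using assms is_subgroupD(2)[OF assms(1), of "(_, _)" "(_, _)"] by (auto simp: bitraj_def)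

lemma bitraj_uminus:
  assumes "is_subgroup R" "s \<in> bitraj R"
  shows "(\<lambda>n. - s n) \<in> bitraj R"
  using assms is_subgroupD(3)[OF assms(1), of "(_, _)"] by (auto simp: bitraj_def)

lemma bitraj_shift:
  assumes "s \<in> bitraj R"
  shows "(\<lambda>i. s (i + k)) \<in> bitraj R"
proof -
  have "(s (i + k), s (i + 1 + k)) \<in> R" for i
    using assms by (auto simp: bitraj_def add_ac dest!: spec[of _ "i + k"])
  then show ?thesis by (simp add: bitraj_def)
qed

lemma traj_shift: "s \<in> traj R \<Longrightarrow> (\<lambda>n. s (k + n)) \<in> traj R"
  by (auto simp: traj_def)

lemma bitraj_imp_traj:
  assumes "s \<in> bitraj R"
  shows "(\<lambda>n. s (int n + k)) \<in> traj R"
proof -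
  have "(s (int n + k), s (int (Suc n) + k)) \<in> R" for n
    using assms by (auto simp: bitraj_def add_ac dest!: spec[of _ "int n + k"])
  then show ?thesis by (simp add: traj_def)
qed

lemma bitraj_imp_traj_converse:
  assumes "s \<in> bitraj R"
  shows "(\<lambda>n. s (k - int n)) \<in> traj (R\<inverse>)"
proof -
  have "(s (k - int (Suc n)), s (k - int n)) \<in> R" for n
    using assms by (auto simp: bitraj_def dest!: spec[of _ "k - int (Suc n)"])
  then show ?thesis by (auto simp: traj_def)
qed

lemma bitraj_glue:
  assumes "b \<in> traj (R\<inverse>)" "f \<in> traj R" "b 0 = f 0"
  shows "\<exists>s\<in>bitraj R. (\<forall>n. s (int n) = f n) \<and> (\<forall>n. s (- int n) = b n)"
proof -
  define s where "s = (\<lambda>i. if i \<ge> 0 then f (nat i) else b (nat (- i)))"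
  have "(s i, s (i + 1)) \<in> R" for i
  proof (cases "i \<ge> 0")
    case True
    then show ?thesis using assms(2) by (auto simp: s_def traj_def nat_add_distrib)
  next
    case False
    define n where "n = nat (- i - 1)"
    have "(b (Suc n), b n) \<in> R" using assms(1) by (auto simp: traj_def)
    moreover have "s i = b (Suc n)" using False by (simp add: s_def n_def Suc_nat_eq_nat_zadd1)
    \<comment> \<open>The value at \<open>0\<close> is taken from \<open>f\<close>, so the step from
      \<open>-1\<close> to \<open>0\<close> relies on \<open>b 0 = f 0\<close>.\<close>
    moreover have "s (i + 1) = b n"
      using False assms(3) by (cases "i = - 1") (auto simp: s_def n_def intro!: arg_cong[of _ _ b])
    ultimately show ?thesis by simp
  qed
  then show ?thesis using assms(3) by (intro bexI[of _ s]) (auto simp: s_def bitraj_def)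
qed

text \<open>Dependent choice. It serves to continue a regressive trajectory in \<open>K\<close> into
  the future without leaving \<open>K\<close>.\<close>

lemma traj_in_stable:
  assumes "\<And>k. k \<in> K \<Longrightarrow> \<exists>k'\<in>K. (k, k') \<in> R" "k \<in> K"
  shows "\<exists>f\<in>traj R. range f \<subseteq> K \<and> f 0 = k"
proof -
  have "\<exists>f. \<forall>n. (f n \<in> K \<and> (n = 0 \<longrightarrow> f n = k)) \<and> (f n, f (Suc n)) \<in> R"
  proof (rule dependent_nat_choice)
    show "\<exists>x. x \<in> K \<and> (0 = (0::nat) \<longrightarrow> x = k)" using assms(2) by blast
    show "\<exists>y. (y \<in> K \<and> (Suc n = 0 \<longrightarrow> y = k)) \<and> (x, y) \<in> R"
      if "x \<in> K \<and> (n = 0 \<longrightarrow> x = k)" for x n using assms(1)[of x] that by auto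
  qed
  then obtain f where "\<forall>n. (f n \<in> K \<and> (n = 0 \<longrightarrow> f n = k)) \<and> (f n, f (Suc n)) \<in> R" ..
  then show ?thesis by (intro bexI[of _ f]) (auto simp: traj_def)
qed

section \<open>Sets of starting points as compact subgroups\<close>

lemma closed_converse:
  fixes R :: "('a::topological_space \<times> 'a) set"
  assumes "closed R"
  shows "closed (R\<inverse>)"
proof -
  have "closed {p. (snd p, fst p) \<in> R}"
    by (intro closed_vimage_UNIV assms continuous_intros)
  also have "{p. (snd p, fst p) \<in> R} = R\<inverse>" by auto
  finally show ?thesis .
qed

text \<open>The trajectories in \<open>A\<close> form a closed subset of the compact product of
  copies of \<open>A\<close>, and evaluation at \<open>0\<close> is continuous.\<close>

lemma compact_fwd:
  fixes R :: "('a::t2_space \<times> 'a) set"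
  assumes "closed R" "compact A"
  shows "compact (fwd R A)"
proof -
  have "closed (\<Inter>n. {s. (s n, s (Suc n)) \<in> R})"
    by (intro closed_INT ballI closed_vimage_UNIV assms continuous_on_Pair continuous_on_product_coordinates)
  then have "compact ({s. \<forall>n. s n \<in> A} \<inter> (\<Inter>n. {s::nat \<Rightarrow> 'a. (s n, s (Suc n)) \<in> R}))"
    by (intro compact_Int_closed compact_fun_box assms)
  then have "compact ((\<lambda>s. s 0) ` ({s. \<forall>n. s n \<in> A} \<inter> (\<Inter>n. {s::nat \<Rightarrow> 'a. (s n, s (Suc n)) \<in> R})))"
    by (intro compact_continuous_image continuous_on_subset[OF continuous_on_product_coordinates]) auto
  also have "\<dots> = fwd R A"
    by (auto simp: fwd_def traj_def image_iff) blast
  finally show ?thesis .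
qed

lemma compact_bicore:
  fixes R :: "('a::t2_space \<times> 'a) set"
  assumes "closed R" "compact A"
  shows "compact (bicore R A)"
proof -
  have "closed (\<Inter>n. {s. (s n, s (n + 1)) \<in> R})"
    by (intro closed_INT ballI closed_vimage_UNIV assms continuous_on_Pair continuous_on_product_coordinates)
  then have "compact ({s. \<forall>n. s n \<in> A} \<inter> (\<Inter>n. {s::int \<Rightarrow> 'a. (s n, s (n + 1)) \<in> R}))"
    by (intro compact_Int_closed compact_fun_box assms)
  then have "compact ((\<lambda>s. s 0) ` ({s. \<forall>n. s n \<in> A} \<inter> (\<Inter>n. {s::int \<Rightarrow> 'a. (s n, s (n + 1)) \<in> R})))"
    by (intro compact_continuous_image continuous_on_subset[OF continuous_on_product_coordinates]) auto
  also have "\<dots> = bicore R A"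
    by (auto simp: bicore_def bitraj_def image_iff) blast
  finally show ?thesis .
qed

lemma zero_traj: "is_subgroup R \<Longrightarrow> (\<lambda>_. 0) \<in> traj R"
  by (auto simp: traj_def is_subgroup_def zero_prod_def)

lemma zero_bitraj: "is_subgroup R \<Longrightarrow> (\<lambda>_. 0) \<in> bitraj R"
  by (auto simp: bitraj_def is_subgroup_def zero_prod_def)

lemma is_subgroup_fwd:
  assumes R: "is_subgroup R" and A: "is_subgroup A"
  shows "is_subgroup (fwd R A)"
  unfolding is_subgroup_def
proof (intro conjI ballI)
  show "0 \<in> fwd R A" using zero_traj[OF R] is_subgroupD(1)[OF A] by (force simp: fwd_def)
next
  fix x y assume "x \<in> fwd R A" "y \<in> fwd R A"
  then obtain s t where "s \<in> traj R" "range s \<subseteq> A" "x = s 0" "t \<in> traj R" "range t \<subseteq> A" "y = t 0"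
    by (auto simp: fwd_def)
  then show "x + y \<in> fwd R A"
    using traj_add[OF R, of s t] is_subgroupD(2)[OF A]
    by (auto simp: fwd_def intro!: exI[of _ "\<lambda>n. s n + t n"])
next
  fix x assume "x \<in> fwd R A"
  then obtain s where "s \<in> traj R" "range s \<subseteq> A" "x = s 0" by (auto simp: fwd_def)
  then show "- x \<in> fwd R A"
    using traj_uminus[OF R, of s] is_subgroupD(3)[OF A]
    by (auto simp: fwd_def intro!: exI[of _ "\<lambda>n. - s n"])
qed

lemma is_subgroup_bicore:
  assumes R: "is_subgroup R" and A: "is_subgroup A"
  shows "is_subgroup (bicore R A)"
  unfolding is_subgroup_def
proof (intro conjI ballI)
  show "0 \<in> bicore R A" using zero_bitraj[OF R] is_subgroupD(1)[OF A] by (force simp: bicore_def)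
next
  fix x y assume "x \<in> bicore R A" "y \<in> bicore R A"
  then obtain s t where "s \<in> bitraj R" "range s \<subseteq> A" "x = s 0" "t \<in> bitraj R" "range t \<subseteq> A" "y = t 0"
    by (auto simp: bicore_def)
  then show "x + y \<in> bicore R A"
    using bitraj_add[OF R, of s t] is_subgroupD(2)[OF A]
    by (auto simp: bicore_def intro!: exI[of _ "\<lambda>n. s n + t n"])
next
  fix x assume "x \<in> bicore R A"
  then obtain s where "s \<in> bitraj R" "range s \<subseteq> A" "x = s 0" by (auto simp: bicore_def)
  then show "- x \<in> bicore R A"
    using bitraj_uminus[OF R, of s] is_subgroupD(3)[OF A]
    by (auto simp: bicore_def intro!: exI[of _ "\<lambda>n. - s n"])
qed

text \<open>A shift of a bi-infinite trajectory is again one, so any index can be made the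
  origin.\<close>

lemma bicore_mem:
  assumes "s \<in> bitraj R" "range s \<subseteq> A"
  shows "s i \<in> bicore R A"
  using bitraj_shift[OF assms(1), of i] assms(2)
  by (auto simp: bicore_def intro!: exI[of _ "\<lambda>j. s (j + i)"])

section \<open>Factorization of small elements\<close>

text \<open>
  The two uses are \<open>K = UNIV\<close>, \<open>\<S> = {UNIV}\<close> (tidiness above in the sense of Willis) and \<open>K\<close> compact
  with \<open>\<S>\<close> its compact thickenings.
\<close>

lemma tidy_factorization:
  fixes R :: "('a::{topological_group_add, t2_space} \<times> 'a) set" and V K Q :: "'a set"
  assumes R: "closed R" "is_subgroup R"
    and V: "compact V" "is_subgroup V" "open V"
    and K: "closed K" "is_subgroup K"
    and stable: "\<And>k. k \<in> K \<Longrightarrow> \<exists>k'\<in>K. (k, k') \<in> R"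
    and nonempty: "\<S> \<noteq> {}"
    and cl: "\<And>S. S \<in> \<S> \<Longrightarrow> closed S"
    and dir: "\<And>S T. S \<in> \<S> \<Longrightarrow> T \<in> \<S> \<Longrightarrow> \<exists>U\<in>\<S>. U \<subseteq> S \<inter> T"
    and inter: "\<Inter>\<S> \<subseteq> K"
    and inv: "\<And>S k s. S \<in> \<S> \<Longrightarrow> k \<in> K \<Longrightarrow> s \<in> S \<Longrightarrow> k + s \<in> S"
    and Q: "compact Q" "\<And>S v y. S \<in> \<S> \<Longrightarrow> v \<in> V \<Longrightarrow> y \<in> S \<Longrightarrow> (v, y) \<in> R \<Longrightarrow> y \<in> Q"
  shows "\<exists>N. \<exists>S\<in>\<S>. \<forall>g\<in>traj R. range g \<subseteq> S \<longrightarrow> (\<forall>j\<le>N. g j \<in> V) \<longrightarrow>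
    (\<exists>h\<in>traj R. range h \<subseteq> V \<and> g 0 - h 0 \<in> fwd (R\<inverse>) (V \<inter> K) \<and> (\<forall>j. g j - h j \<in> K))"
proof -
  \<comment> \<open>These are the points reached by trajectories in \<open>K\<close> whose entire
    past before that point lies in \<open>V\<close>. The point itself may lie outside
    \<open>V\<close>.\<close>
  define U where "U = {t 0 |t. t \<in> traj (R\<inverse>) \<and> range t \<subseteq> K \<and> (\<forall>j. t (Suc j) \<in> V)}"
  define B where "B = fwd (R\<inverse>) (V \<inter> K)"
  have "0 \<in> V" using V by (simp add: is_subgroup_def)
  have B: "compact B" "is_subgroup B"
    unfolding B_def using R V K
    by (auto intro!: compact_fwd is_subgroup_fwd is_subgroup_Int is_subgroup_converse
      closed_converse compact_Int_closed)
  \<comment> \<open>Otherwise a limit of counterexamples is a regressive trajectory in \<open>K\<close> starting in \<open>U\<close>, although its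
    starting point is a limit of points outside the open set \<open>U + V\<close>.\<close>
  have escape: "\<exists>N. \<exists>S\<in>\<S>. \<forall>g\<in>traj R. range g \<subseteq> S \<longrightarrow>
      (\<forall>m. (\<forall>j\<le>N. g (m + j) \<in> V) \<longrightarrow> (\<exists>u\<in>U. - u + g (Suc (m + N)) \<in> V))"
  proof (rule ccontr)
    assume contra: "\<not> ?thesis"
    define UV where "UV = sumset U V"
    \<comment> \<open>Index \<open>0\<close> belongs to the position one step after the last one
      known to lie in \<open>V\<close>; only \<open>Q\<close> confines it.\<close>
    define X where "X = (\<lambda>n::nat. if n = 0 then Q else V)"
    define A where "A = (\<lambda>(N::nat, S). {h. h 0 \<in> - UV} \<inter> (\<Inter>j\<in>{..Suc N}. {h. h j \<in> S})
       \<inter> (\<Inter>j\<in>{..N}. {h. (h (Suc j), h j) \<in> R}))"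
    have A_iff: "h \<in> A (N, S) \<longleftrightarrow> h 0 \<notin> UV \<and> (\<forall>j\<le>Suc N. h j \<in> S) \<and> (\<forall>j\<le>N. (h (Suc j), h j) \<in> R)"
      for h N S by (auto simp: A_def)
    have A_antimono: "A (N', S') \<subseteq> A (N, S)" if "N \<le> N'" "S' \<subseteq> S" for N N' S S'
    proof
      fix h assume "h \<in> A (N', S')"
      then show "h \<in> A (N, S)"
        using that unfolding A_iff by (meson Suc_le_mono le_trans subsetD)
    qed
    have "open UV" unfolding UV_def by (rule open_sumset[OF V(3)])
    have "\<exists>h\<in>{h. \<forall>n. h n \<in> X n}. \<forall>p\<in>UNIV \<times> \<S>. h \<in> A p"
    proof (rule compact_directed_Inter)
      show "compact {h. \<forall>n. h n \<in> X n}"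
        using Q V by (intro compact_fun_box) (simp add: X_def)
      show "UNIV \<times> \<S> \<noteq> {}" using nonempty by simp
      fix p assume "p \<in> (UNIV::nat set) \<times> \<S>"
      then obtain N S where p: "p = (N, S)" "S \<in> \<S>" by auto
      show "closed (A p)"
        using cl[OF p(2)] R \<open>open UV\<close> unfolding A_def p(1) prod.case
        by (intro closed_Int closed_INT ballI closed_vimage_UNIV continuous_on_Pair
            continuous_on_product_coordinates) auto
      show "{h. \<forall>n. h n \<in> X n} \<inter> A p \<noteq> {}"
      proof -
        obtain g m where g: "g \<in> traj R" "range g \<subseteq> S" "\<And>j. j \<le> N \<Longrightarrow> g (m + j) \<in> V"
          and no: "\<And>u. u \<in> U \<Longrightarrow> - u + g (Suc (m + N)) \<notin> V"
        proof -
          have "\<not> (\<forall>g\<in>traj R. range g \<subseteq> S \<longrightarrow>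
              (\<forall>m. (\<forall>j\<le>N. g (m + j) \<in> V) \<longrightarrow> (\<exists>u\<in>U. - u + g (Suc (m + N)) \<in> V)))" (is "\<not> ?Q")
          proof
            assume ?Q
            show False by (rule notE[OF contra], intro exI[of _ N] bexI[of _ S]) (fact \<open>?Q\<close>, fact p(2))
          qed
          then show ?thesis using that by (simp only: Ball_def Bex_def) metis
        qed
        \<comment> \<open>Time is reversed, so that \<open>g (Suc (m + N))\<close> gets index
          \<open>0\<close>. The default \<open>0\<close> beyond \<open>Suc N\<close> lies in
          \<open>V\<close> and is not tested by \<open>A (N, S)\<close>.\<close>
        define h where "h = (\<lambda>j. if j \<le> Suc N then g (m + (Suc N - j)) else 0)"
        have step: "(g i, g (Suc i)) \<in> R" for i using g(1) by (auto simp: traj_def)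
        have "(g (m + N), g (Suc (m + N))) \<in> R" by (rule step)
        then have "h 0 \<in> Q" using Q(2)[OF p(2) g(3)[of N]] g(2) by (auto simp: h_def)
        moreover have "h n \<in> V" if "n \<noteq> 0" for n
          using g(3)[of "Suc N - n"] \<open>0 \<in> V\<close> that by (auto simp: h_def)
        moreover have "h 0 \<notin> UV"
        proof
          assume "h 0 \<in> UV"
          then obtain u v where "u \<in> U" "v \<in> V" "g (Suc (m + N)) = u + v"
            by (auto simp: UV_def sumset_def h_def)
          then show False using no[of u] by (simp add: add.assoc[symmetric])
        qed
        moreover have "h j \<in> S" if "j \<le> Suc N" for j using g(2) that by (auto simp: h_def)
        moreover have "(h (Suc j), h j) \<in> R" if "j \<le> N" for j
          using step[of "m + (N - j)"] that by (simp add: h_def Suc_diff_le)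
        ultimately have "h \<in> {h. \<forall>n. h n \<in> X n} \<inter> A p"
          unfolding p(1) by (auto simp: A_iff X_def)
        then show ?thesis by blast
      qed
      fix q assume "q \<in> (UNIV::nat set) \<times> \<S>"
      then obtain M T where q: "q = (M, T)" "T \<in> \<S>" by auto
      obtain W where "W \<in> \<S>" "W \<subseteq> S \<inter> T" using dir p q by blast
      then have "A (max N M, W) \<subseteq> A p \<inter> A q"
        unfolding p q by (intro Int_greatest A_antimono) auto
      then show "\<exists>k\<in>UNIV \<times> \<S>. A k \<subseteq> A p \<inter> A q"
        using \<open>W \<in> \<S>\<close> by (intro bexI[of _ "(max N M, W)"]) auto
    qed
    then obtain h where hX: "\<And>n. h n \<in> X n" and hA: "\<And>N S. S \<in> \<S> \<Longrightarrow> h \<in> A (N, S)" by auto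
    have "h j \<in> K" for j
    proof -
      have "h j \<in> S" if "S \<in> \<S>" for S using hA[OF that, of j] by (simp add: A_iff)
      then show ?thesis using inter by blast
    qed
    moreover have "h (Suc j) \<in> V" for j using hX[of "Suc j"] by (simp add: X_def)
    moreover have "(h (Suc j), h j) \<in> R" for j using nonempty hA[of _ j] by (auto simp: A_iff)
    ultimately have "h 0 \<in> U" by (auto simp: U_def traj_def)
    then have "h 0 + 0 \<in> UV" using \<open>0 \<in> V\<close> unfolding UV_def by (rule sumsetI)
    then show False using nonempty hA[of _ 0] by (auto simp: A_iff)
  qed
  then obtain N S where S: "S \<in> \<S>" and esc: "\<And>g m. g \<in> traj R \<Longrightarrow> range g \<subseteq> S \<Longrightarrow>
      (\<And>j. j \<le> N \<Longrightarrow> g (m + j) \<in> V) \<Longrightarrow> \<exists>u\<in>U. - u + g (Suc (m + N)) \<in> V"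
    by metis
  \<comment> \<open>Subtracting a suitable trajectory in \<open>K\<close> keeps \<open>g\<close> in
    \<open>V\<close> for one step more. The correction follows the past of the element of
    \<open>U\<close> that \<open>esc\<close> provides for time \<open>Suc (m + N)\<close>; as this
    past lies in \<open>V\<close>, the earlier terms remain in \<open>V\<close>.\<close>
  have extend: "\<exists>c\<in>traj R. range c \<subseteq> K \<and> c 0 \<in> B \<and> (\<forall>j\<le>Suc (m + N). - c j + g j \<in> V)"
    if g: "g \<in> traj R" "range g \<subseteq> S" "\<And>j. j \<le> m + N \<Longrightarrow> g j \<in> V" for g m
  proof -
    obtain t where t: "t \<in> traj (R\<inverse>)" "range t \<subseteq> K" "\<And>j. t (Suc j) \<in> V"
        "- t 0 + g (Suc (m + N)) \<in> V"
      using esc[OF g(1,2), of m] g(3) by (auto simp: U_def)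
    obtain f where f: "f \<in> traj R" "range f \<subseteq> K" "f 0 = t 0"
      using traj_in_stable[OF stable, of "t 0"] t(2) by blast
    obtain s where s: "s \<in> bitraj R" "\<And>n. s (int n) = f n" "\<And>n. s (- int n) = t n"
      using bitraj_glue[OF t(1) f(1)] f(3) by metis
    define M where "M = Suc (m + N)"
    \<comment> \<open>The origin is moved so that time \<open>M\<close> carries \<open>t 0\<close>.
      Then \<open>c 0 = t M\<close> starts a regressive trajectory in \<open>V \<inter> K\<close>,
      which puts it in \<open>B\<close>.\<close>
    define c where "c = (\<lambda>n. s (int n + - int M))"
    have c_back: "c n = t (M - n)" if "n \<le> M" for n
      using s(3)[of "M - n"] that by (simp add: c_def of_nat_diff)
    have "c n \<in> K" for n
    proof (cases "n \<le> M")
      case True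
      then show ?thesis using c_back t(2) by auto
    next
      case False
      then show ?thesis using s(2)[of "n - M"] f(2) by (auto simp: c_def of_nat_diff)
    qed
    moreover have "c \<in> traj R" unfolding c_def by (rule bitraj_imp_traj[OF s(1)])
    moreover have "c 0 \<in> B"
    proof -
      have "(\<lambda>n. t (M + n)) \<in> traj (R\<inverse>)" by (rule traj_shift[OF t(1)])
      moreover have "t (M + n) \<in> V \<inter> K" for n using t(2) t(3)[of "m + N + n"] by (auto simp: M_def)
      ultimately show ?thesis
        unfolding B_def fwd_def using c_back[of 0] by (auto intro!: exI[of _ "\<lambda>n. t (M + n)"])
    qed
    moreover have "- c j + g j \<in> V" if "j \<le> M" for j
    proof (cases "j = M")
      case True
      then show ?thesis using c_back[of M] t(4) by (simp add: M_def)
    next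
      case False
      then have "c j \<in> V" using c_back[of j] t(3)[of "M - j - 1"] that by (simp add: Suc_diff_Suc)
      then show ?thesis using g(3)[of j] False that is_subgroupD[OF V(2)] by (simp add: M_def)
    qed
    ultimately show ?thesis unfolding M_def by blast
  qed
  \<comment> \<open>Iteration of \<open>extend\<close> with \<open>N\<close> fixed. By
    \<open>inv\<close> a corrected trajectory still lies in \<open>S\<close>, and since
    \<open>B\<close> is a subgroup the accumulated correction still starts in
    \<open>B\<close>.\<close>
  have correct: "\<exists>c\<in>traj R. range c \<subseteq> K \<and> c 0 \<in> B \<and> (\<forall>j\<le>m + N. - c j + g j \<in> V)"
    if g: "g \<in> traj R" "range g \<subseteq> S" "\<And>j. j \<le> N \<Longrightarrow> g j \<in> V" for g m
  proof (induction m)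
    case 0
    show ?case
      using g is_subgroupD(1)[OF K(2)] is_subgroupD(1)[OF B(2)] zero_traj[OF R(2)]
      by (intro bexI[of _ "\<lambda>_. 0"]) auto
  next
    case (Suc m)
    then obtain c where c: "c \<in> traj R" "range c \<subseteq> K" "c 0 \<in> B" "\<And>j. j \<le> m + N \<Longrightarrow> - c j + g j \<in> V"
      by blast
    have tr: "(\<lambda>j. - c j + g j) \<in> traj R"
      using traj_add[OF R(2) traj_uminus[OF R(2) c(1)] g(1)] .
    have rg: "range (\<lambda>j. - c j + g j) \<subseteq> S"
      using c(2) g(2) inv[OF S] is_subgroupD(3)[OF K(2)] by blast
    obtain c' where c': "c' \<in> traj R" "range c' \<subseteq> K" "c' 0 \<in> B"
        "\<And>j. j \<le> Suc (m + N) \<Longrightarrow> - c' j + (- c j + g j) \<in> V"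
      using extend[OF tr rg, of m] c(4) by blast
    have "- (c j + c' j) + g j \<in> V" if "j \<le> Suc m + N" for j
      using c'(4)[of j] that by (simp add: minus_add add.assoc[symmetric])
    then show ?case
      using traj_add[OF R(2) c(1) c'(1)] c(2,3) c'(2,3) is_subgroupD(2)[OF K(2)] is_subgroupD(2)[OF B(2)]
      by (intro bexI[of _ "\<lambda>j. c j + c' j"]) (auto simp: image_subset_iff)
  qed
  have "\<exists>h\<in>traj R. range h \<subseteq> V \<and> g 0 - h 0 \<in> B \<and> (\<forall>j. g j - h j \<in> K)"
    if g: "g \<in> traj R" "range g \<subseteq> S" "\<And>j. j \<le> N \<Longrightarrow> g j \<in> V" for g
  proof -
    \<comment> \<open>The \<open>m\<close>-th set asks for the factorization up to time
      \<open>m\<close> only. This much is supplied by \<open>correct\<close>, and compactness of the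
      sequences in \<open>V\<close> then provides one \<open>h\<close> for all times.\<close>
    define A where "A = (\<lambda>m::nat. {h. g 0 - h 0 \<in> B} \<inter> (\<Inter>j\<in>{..<m}. {h. (h j, h (Suc j)) \<in> R})
       \<inter> (\<Inter>j\<in>{..m}. {h. g j - h j \<in> K}))"
    have A_iff: "h \<in> A m \<longleftrightarrow> g 0 - h 0 \<in> B \<and> (\<forall>j<m. (h j, h (Suc j)) \<in> R) \<and> (\<forall>j\<le>m. g j - h j \<in> K)"
      for h m by (auto simp: A_def)
    have A_antimono: "A m' \<subseteq> A m" if "m \<le> m'" for m m'
    proof
      fix h assume "h \<in> A m'"
      then show "h \<in> A m"
        using that unfolding A_iff by (meson le_trans less_le_trans)
    qed
    have "\<exists>h\<in>{h. \<forall>n. h n \<in> V}. \<forall>m\<in>UNIV. h \<in> A m"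
    proof (rule compact_directed_Inter)
      show "compact {h::nat \<Rightarrow> 'a. \<forall>n. h n \<in> V}" using V by (intro compact_fun_box)
      show "(UNIV::nat set) \<noteq> {}" by simp
      fix m :: nat
      show "closed (A m)"
        using R K(1) compact_imp_closed[OF B(1)] unfolding A_def
        by (intro closed_Int closed_INT ballI closed_vimage_UNIV continuous_on_Pair continuous_on_diff
            continuous_on_const continuous_on_product_coordinates) auto
      obtain c where c: "c \<in> traj R" "range c \<subseteq> K" "c 0 \<in> B" "\<And>j. j \<le> m + N \<Longrightarrow> - c j + g j \<in> V"
        using correct[OF g, of m] by blast
      have tr: "(\<lambda>j. - c j + g j) \<in> traj R"
        using traj_add[OF R(2) traj_uminus[OF R(2) c(1)] g(1)] .
      \<comment> \<open>The cut-off with default \<open>0 \<in> V\<close> keeps \<open>h\<close>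
        inside the compact box. Only steps below \<open>m\<close> are tested, so the break after
        \<open>m\<close> does no harm.\<close>
      define h where "h = (\<lambda>j. if j \<le> m then - c j + g j else 0)"
      have "g j - h j = c j" if "j \<le> m" for j
        using that by (simp add: h_def diff_conv_add_uminus minus_add add.assoc[symmetric]
            del: add_uminus_conv_diff)
      moreover have "h n \<in> V" for n using c(4)[of n] \<open>0 \<in> V\<close> by (simp add: h_def)
      moreover have "(h j, h (Suc j)) \<in> R" if "j < m" for j
        using tr that by (auto simp: h_def traj_def)
      ultimately have "h \<in> {h. \<forall>n. h n \<in> V} \<inter> A m" using c(2,3) by (auto simp: A_iff)
      then show "{h. \<forall>n. h n \<in> V} \<inter> A m \<noteq> {}" by blast
      fix n :: nat
      show "\<exists>k\<in>UNIV. A k \<subseteq> A m \<inter> A n"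
        by (rule bexI[of _ "max m n"]) (simp_all add: A_antimono)
    qed
    then obtain h where "\<And>n. h n \<in> V" "\<And>m. h \<in> A m" by auto
    then show ?thesis
      unfolding A_iff by (intro bexI[of _ h]) (auto simp: traj_def)
  qed
  then show ?thesis unfolding B_def using S by blast
qed

text \<open>A cluster point of the shifts of \<open>d\<close> is bi-infinite because the available
  past grows with the shift. The filter \<open>F\<close> allows the limit to be taken along a
  prescribed infinite set of times.\<close>

lemma traj_cluster:
  fixes R :: "('a::t2_space \<times> 'a) set"
  assumes R: "closed R" and d: "d \<in> traj R" "range d \<subseteq> C" and C: "compact C"
    and F: "F \<noteq> bot" "F \<le> sequentially"
  shows "\<exists>h\<in>bitraj R. range h \<subseteq> C \<and>
    (\<forall>U. open U \<longrightarrow> h \<in> U \<longrightarrow> (\<exists>\<^sub>F m in F. (\<lambda>i. d (nat (int m + i))) \<in> U)) \<and>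
    (\<forall>A. closed A \<longrightarrow> eventually (\<lambda>m. d m \<in> A) sequentially \<longrightarrow> range h \<subseteq> A)"
proof -
  \<comment> \<open>Negative times are cut off to \<open>0\<close> by \<open>nat\<close>; for a
    fixed \<open>i\<close> this affects only finitely many \<open>m\<close>.\<close>
  define sh where "sh = (\<lambda>m i. d (nat (int m + i)))"
  have "\<forall>\<^sub>F s in filtermap sh F. s \<in> {s. \<forall>i. s i \<in> C}"
    unfolding eventually_filtermap using d(2) by (intro always_eventually) (auto simp: sh_def)
  moreover have "filtermap sh F \<noteq> bot" using F(1) by (simp add: filtermap_bot_iff)
  moreover have "compact {s::int \<Rightarrow> 'a. \<forall>i. s i \<in> C}" using C by (intro compact_fun_box)
  ultimately obtain h where h: "\<And>i. h i \<in> C" "inf (nhds h) (filtermap sh F) \<noteq> bot"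
    unfolding compact_filter by blast
  have freq: "\<exists>\<^sub>F m in F. sh m \<in> U" if "open U" "h \<in> U" for U
  proof (rule ccontr)
    assume "\<not> ?thesis"
    then have "eventually (\<lambda>s. s \<notin> U) (filtermap sh F)"
      by (simp add: frequently_def eventually_filtermap)
    moreover have "eventually (\<lambda>s. s \<in> U) (nhds h)" using that by (rule eventually_nhds_in_open)
    ultimately have "eventually (\<lambda>_. False) (inf (nhds h) (filtermap sh F))"
      unfolding eventually_inf by blast
    then show False using h(2) by (simp add: eventually_False)
  qed
  have limit: "h \<in> A" if "closed A" "eventually (\<lambda>m. sh m \<in> A) sequentially" for A
  proof (rule ccontr)
    assume "h \<notin> A"
    then have "\<exists>\<^sub>F m in F. sh m \<in> - A" using that by (intro freq) auto
    moreover have "eventually (\<lambda>m. sh m \<in> A) F" using that(2) F(2) by (rule filter_leD[rotated])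
    ultimately show False by (simp add: frequently_def)
  qed
  have ev: "eventually (\<lambda>m. P (nat (int m + i)) (nat (int m + (i + 1)))) sequentially"
    if P: "eventually (\<lambda>m. P m (Suc m)) sequentially" for P i
  proof -
    obtain M where M: "\<And>m. m \<ge> M \<Longrightarrow> P m (Suc m)" using P by (auto simp: eventually_sequentially)
    have "P (nat (int m + i)) (nat (int m + (i + 1)))" if "m \<ge> M + nat (- i)" for m
    proof -
      have "nat (int m + (i + 1)) = Suc (nat (int m + i))" using that by (simp add: nat_add_distrib[symmetric] Suc_nat_eq_nat_zadd1 add_ac)
      moreover have "nat (int m + i) \<ge> M" using that by linarith
      ultimately show ?thesis using M by simp
    qed
    then show ?thesis unfolding eventually_sequentially by blast
  qed
  show ?thesis
  proof (intro bexI[of _ h] conjI allI impI)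
    have "h \<in> {s. (s i, s (i + 1)) \<in> R}" for i
    proof (rule limit)
      show "closed {s. (s i, s (i + 1)) \<in> R}"
        by (intro closed_vimage_UNIV R continuous_on_Pair continuous_on_product_coordinates)
      show "\<forall>\<^sub>F m in sequentially. sh m \<in> {s. (s i, s (i + 1)) \<in> R}"
        using ev[of "\<lambda>a b. (d a, d b) \<in> R" i] d(1) by (simp add: sh_def traj_def)
    qed
    then show "h \<in> bitraj R" by (simp add: bitraj_def)
    show "range h \<subseteq> C" using h(1) by auto
    show "\<exists>\<^sub>F m in F. (\<lambda>i. d (nat (int m + i))) \<in> U" if "open U" "h \<in> U" for U
      using freq[OF that] by (simp add: sh_def)
    show "range h \<subseteq> A" if A: "closed A" "eventually (\<lambda>m. d m \<in> A) sequentially" for A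
    proof -
      have "h \<in> {s. s i \<in> A}" for i
      proof (rule limit)
        show "closed {s. s i \<in> A}" by (intro closed_vimage_UNIV A continuous_on_product_coordinates)
        show "\<forall>\<^sub>F m in sequentially. sh m \<in> {s. s i \<in> A}"
          using ev[of "\<lambda>a b. d a \<in> A" i] A(2) by (simp add: sh_def)
      qed
      then show ?thesis by auto
    qed
  qed
qed

section \<open>Asymptotic bi-infinite trajectories\<close>

lemma relatively_compact_subset:
  fixes S :: "'a::t2_space set"
  assumes "compact C" "S \<subseteq> C"
  shows "relatively_compact S"
proof -
  have "closure S \<subseteq> C" using assms by (simp add: closure_minimal compact_imp_closed)
  then show ?thesis
    unfolding relatively_compact_def using closed_Int_compact[OF closed_closure[of S] assms(1)]
    by (simp add: Int_absorb2)
qed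

lemma relatively_compact_sumset:
  fixes A B :: "'a::{topological_group_add, t2_space} set"
  assumes "relatively_compact A" "relatively_compact B" "S \<subseteq> sumset A B"
  shows "relatively_compact S"
proof (rule relatively_compact_subset)
  show "compact (sumset (closure A) (closure B))"
    using assms(1,2) unfolding relatively_compact_def by (rule compact_sumset)
  show "S \<subseteq> sumset (closure A) (closure B)"
    using assms(3) sumset_mono[OF closure_subset closure_subset] by (rule subset_trans)
qed

lemma relatively_compact_uminus:
  fixes A :: "'a::{topological_group_add, t2_space} set"
  assumes "relatively_compact A"
  shows "relatively_compact (uminus ` A)"
proof (rule relatively_compact_subset)
  show "compact (uminus ` closure A)"
    using assms unfolding relatively_compact_def
    by (intro compact_continuous_image continuous_intros)
  show "uminus ` A \<subseteq> uminus ` closure A" using closure_subset by (rule image_mono)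
qed

lemma relatively_compact_compact:
  fixes A :: "'a::t2_space set"
  shows "compact A \<Longrightarrow> relatively_compact A"
  by (simp add: relatively_compact_subset)

lemma add_cancel_middle: "(a + b) + (- b + c) = a + (c :: 'a::group_add)"
  by (simp add: add.assoc[symmetric])

text \<open>Interpreted both for the graph of \<open>\<alpha>\<close> and for its converse, so that
  one argument yields both decompositions. The assumption \<open>small_factor\<close> says that the
  sum of the two subgroups \<open>fwd (R\<inverse>) V\<close> and \<open>fwd R V\<close> is a
  neighbourhood of \<open>0\<close>.\<close>

locale tdlc_relation =
  fixes R :: "('a::{topological_group_add, t2_space} \<times> 'a) set"
  assumes closed_R: "closed R" and subgroup_R: "is_subgroup R"
    and small_subgroup: "\<And>N::'a set. open N \<Longrightarrow> 0 \<in> N \<Longrightarrow> \<exists>H. compact H \<and> open H \<and> is_subgroup H \<and> H \<subseteq> N"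
    and small_factor: "\<And>V. compact V \<Longrightarrow> open V \<Longrightarrow> is_subgroup V \<Longrightarrow>
      \<exists>W. open W \<and> 0 \<in> W \<and> (\<forall>w\<in>W. \<exists>b\<in>fwd (R\<inverse>) V. \<exists>f\<in>fwd R V. w = b + f)"
begin

text \<open>Here \<open>y\<close> is asymptotic to \<open>x\<close> up to an error in
  \<open>K\<close>, convergence to \<open>K\<close> being expressed by the thickenings
  \<open>K + U\<close>. The goal is the case \<open>K = {0}\<close>.\<close>

definition tracks :: "(nat \<Rightarrow> 'a) \<Rightarrow> 'a set \<Rightarrow> (int \<Rightarrow> 'a) \<Rightarrow> bool" where
  "tracks x K y \<longleftrightarrow> compact K \<and> is_subgroup K \<and> K \<subseteq> bicore R K \<and> y \<in> bitraj R \<and>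
     relatively_compact (range y) \<and>
     (\<forall>U. open U \<longrightarrow> 0 \<in> U \<longrightarrow> (\<forall>\<^sub>F n in sequentially. - y (int n) + x n \<in> sumset K U))"

text \<open>If \<open>d\<close> stayed away from the stable core infinitely often, a cluster point
  along those times would be a bi-infinite trajectory in \<open>B\<close>. Its term at
  \<open>0\<close> lies in the core and is approached by \<open>d\<close> along the same times, a
  contradiction.\<close>

lemma tendsto_bicore:
  assumes d: "d \<in> traj R" "relatively_compact (range d)"
    and cl: "\<And>A. A \<in> \<A> \<Longrightarrow> closed A"
    and ev: "\<And>A. A \<in> \<A> \<Longrightarrow> \<forall>\<^sub>F n in sequentially. d n \<in> A"
    and sub: "\<Inter>\<A> \<subseteq> B"
    and U: "open U" "0 \<in> U"
  shows "\<forall>\<^sub>F n in sequentially. d n \<in> sumset (bicore R B) U"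
proof (rule ccontr)
  assume contra: "\<not> ?thesis"
  \<comment> \<open>The filter of late times at which the claimed membership fails.\<close>
  define F where "F = inf sequentially (principal {n. d n \<notin> sumset (bicore R B) U})"
  have "F \<noteq> bot"
    using contra unfolding F_def trivial_limit_def eventually_inf_principal by simp
  moreover have "F \<le> sequentially" by (simp add: F_def)
  moreover have "range d \<subseteq> closure (range d)" by (rule closure_subset)
  moreover have "compact (closure (range d))" using d(2) by (simp add: relatively_compact_def)
  ultimately obtain h where h: "h \<in> bitraj R"
      and freq: "\<And>U. open U \<Longrightarrow> h \<in> U \<Longrightarrow> \<exists>\<^sub>F m in F. (\<lambda>i. d (nat (int m + i))) \<in> U"
      and lim: "\<And>A. closed A \<Longrightarrow> eventually (\<lambda>m. d m \<in> A) sequentially \<Longrightarrow> range h \<subseteq> A"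
    using traj_cluster[OF closed_R d(1)] by meson
  have "range h \<subseteq> B" using lim[OF cl ev] sub by blast
  then have h0: "h 0 \<in> bicore R B" by (rule bicore_mem[OF h])
  have "\<exists>\<^sub>F m in F. (\<lambda>i. d (nat (int m + i))) \<in> {s. - h 0 + s 0 \<in> U}"
  proof (rule freq)
    show "open {s. - h 0 + s 0 \<in> U}"
      by (intro open_vimage_UNIV U(1) continuous_on_add continuous_on_const continuous_on_product_coordinates)
    show "h \<in> {s. - h 0 + s 0 \<in> U}" using U by simp
  qed
  then have "\<exists>\<^sub>F m in F. d m \<in> sumset (bicore R B) U"
  proof (rule frequently_elim1)
    fix m assume "(\<lambda>i. d (nat (int m + i))) \<in> {s. - h 0 + s 0 \<in> U}"
    then have "h 0 + (- h 0 + d m) \<in> sumset (bicore R B) U" using h0 by (intro sumsetI) auto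
    then show "d m \<in> sumset (bicore R B) U" by (simp add: add.assoc[symmetric])
  qed
  then show False by (simp add: frequently_def F_def eventually_inf_principal)
qed

text \<open>The complement of \<open>K\<close> is open, so for \<open>p\<close> outside
  \<open>K\<close> a small subgroup \<open>P\<close> satisfies
  \<open>p \<notin> K + P\<close>.\<close>

lemma Inter_thickenings:
  fixes K V :: "'a set"
  assumes "compact K" "open V" "0 \<in> V"
  shows "\<Inter>(sumset K ` {P. compact P \<and> open P \<and> is_subgroup P \<and> P \<subseteq> V}) \<subseteq> K"
proof
  fix p assume p: "p \<in> \<Inter>(sumset K ` {P. compact P \<and> open P \<and> is_subgroup P \<and> P \<subseteq> V})"
  show "p \<in> K"
  proof (rule ccontr)
    assume "p \<notin> K"
    have "closed K" using assms(1) by (rule compact_imp_closed)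
    have "open ({u. p - u \<in> - K} \<inter> V)"
      using \<open>closed K\<close> assms by (intro open_Int open_vimage_UNIV continuous_intros) auto
    moreover have "0 \<in> {u. p - u \<in> - K} \<inter> V" using \<open>p \<notin> K\<close> assms by simp
    ultimately obtain P where P: "compact P" "open P" "is_subgroup P" "P \<subseteq> {u. p - u \<in> - K} \<inter> V"
      using small_subgroup by metis
    then have "p \<in> sumset K P" using p by blast
    then obtain k u where "k \<in> K" "u \<in> P" "p = k + u" by (rule sumsetE)
    then show False using P(4) by auto
  qed
qed

text \<open>A change of \<open>y\<close> by a bi-infinite trajectory in \<open>K\<close> absorbs all
  of the error \<open>- y + x\<close> except, from some time on, a trajectory \<open>v\<close> in
  \<open>V\<close>. The new error lies eventually in \<open>V\<close> and still approaches
  \<open>K\<close>, so it approaches the stable core of \<open>V \<inter> K\<close>.\<close>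

lemma tracks_refine:
  assumes x: "x \<in> traj R" "relatively_compact (range x)" and Ky: "tracks x K y"
    and V: "compact V" "open V" "is_subgroup V"
  shows "\<exists>K' y'. tracks x K' y' \<and> K' \<subseteq> V \<inter> K \<and> (\<forall>i. - y i + y' i \<in> K)"
proof -
  have K: "compact K" "is_subgroup K" "K \<subseteq> bicore R K" and y: "y \<in> bitraj R" "relatively_compact (range y)"
    and near: "\<And>U. open U \<Longrightarrow> 0 \<in> U \<Longrightarrow> \<forall>\<^sub>F n in sequentially. - y (int n) + x n \<in> sumset K U"
    using Ky by (auto simp: tracks_def)
  have "closed K" using K(1) by (rule compact_imp_closed)
  have "0 \<in> V" using V(3) by (rule is_subgroupD)
  define d where "d = (\<lambda>n. - y (int n) + x n)"
  have d: "d \<in> traj R"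
    using traj_add[OF subgroup_R traj_uminus[OF subgroup_R] x(1)] bitraj_imp_traj[OF y(1), of 0]
    by (simp add: d_def)
  have d_bdd: "relatively_compact (range d)"
    by (rule relatively_compact_sumset[OF relatively_compact_uminus[OF y(2)] x(2)])
      (auto simp: d_def intro!: sumsetI)
  \<comment> \<open>Subgroups inside \<open>V\<close> suffice to shrink the thickenings
    \<open>K + P\<close> to \<open>K\<close>, and they keep all of them inside the compact set
    \<open>K + V\<close>, which serves as \<open>Q\<close> in the factorization.\<close>
  define \<O> where "\<O> = {P. compact P \<and> open P \<and> is_subgroup P \<and> P \<subseteq> V}"
  have \<O>D: "compact P" "open P" "0 \<in> P" "P \<subseteq> V" if "P \<in> \<O>" for P
    using that by (auto simp: \<O>_def is_subgroup_def)
  have inter: "\<Inter>(sumset K ` \<O>) \<subseteq> K"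
    unfolding \<O>_def using V \<open>0 \<in> V\<close> by (intro Inter_thickenings K) auto
  have closed_thick: "closed (sumset K P)" if "P \<in> \<O>" for P
    using \<O>D[OF that] K(1) by (intro compact_imp_closed compact_sumset)
  have thick_inv: "k + s \<in> sumset K P" if "k \<in> K" "s \<in> sumset K P" for k s P
    using that(2)
  proof (rule sumsetE)
    fix a b assume "a \<in> K" "b \<in> P" "s = a + b"
    then show ?thesis
      using is_subgroupD(2)[OF K(2) that(1), of a] sumsetI[of "k + a" K b P] by (simp add: add.assoc)
  qed
  have d_near: "\<forall>\<^sub>F n in sequentially. d n \<in> sumset K P" if "P \<in> \<O>" for P
    unfolding d_def using \<O>D[OF that] near by blast
  define factors where "factors N S \<longleftrightarrow> (\<forall>g\<in>traj R. range g \<subseteq> S \<longrightarrow> (\<forall>j\<le>N. g j \<in> V) \<longrightarrow>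
    (\<exists>h\<in>traj R. range h \<subseteq> V \<and> g 0 - h 0 \<in> fwd (R\<inverse>) (V \<inter> K) \<and> (\<forall>j. g j - h j \<in> K)))"
    for N :: nat and S
  have "\<exists>N. \<exists>S\<in>sumset K ` \<O>. factors N S"
    unfolding factors_def
  proof (rule tidy_factorization[where Q = "sumset K V"])
    show "closed R" "is_subgroup R" "compact V" "is_subgroup V" "open V" "closed K" "is_subgroup K"
      by (rule closed_R subgroup_R V \<open>closed K\<close> K)+
    show "\<exists>k'\<in>K. (k, k') \<in> R" if "k \<in> K" for k
    proof -
      have "k \<in> bicore R K" using K(3) that by blast
      then obtain s where s: "s \<in> bitraj R" "range s \<subseteq> K" "s 0 = k" by (rule bicoreE)
      then have "(s 0, s (0 + 1)) \<in> R" unfolding bitraj_def by blast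
      then show ?thesis using s by (intro bexI[of _ "s (0 + 1)"]) auto
    qed
    have "V \<in> \<O>" using V by (simp add: \<O>_def)
    then show "sumset K ` \<O> \<noteq> {}" by blast
    show "closed S" if "S \<in> sumset K ` \<O>" for S using that closed_thick by blast
    show "\<exists>W\<in>sumset K ` \<O>. W \<subseteq> S \<inter> T" if ST: "S \<in> sumset K ` \<O>" "T \<in> sumset K ` \<O>" for S T
    proof -
      obtain P P' where OP: "P \<in> \<O>" "P' \<in> \<O>" "S = sumset K P" "T = sumset K P'"
        using ST by blast
      then have "P \<inter> P' \<in> \<O>"
        by (auto simp: \<O>_def intro: is_subgroup_Int compact_Int)
      then show ?thesis
        unfolding OP(3,4) by (intro bexI[of _ "sumset K (P \<inter> P')"] Int_greatest sumset_mono) auto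
    qed
    show "\<Inter>(sumset K ` \<O>) \<subseteq> K" by fact
    show "k + s \<in> S" if "S \<in> sumset K ` \<O>" "k \<in> K" "s \<in> S" for S k s
      using that thick_inv by blast
    show "compact (sumset K V)" using K(1) V(1) by (rule compact_sumset)
    show "z \<in> sumset K V" if z: "S \<in> sumset K ` \<O>" "z \<in> S" for S z
    proof -
      obtain P where "P \<in> \<O>" "S = sumset K P" using z(1) by blast
      then show ?thesis using z(2) sumset_mono[OF order_refl \<O>D(4)[of P], of K] by blast
    qed
  qed
  then obtain N P where P: "P \<in> \<O>" "factors N (sumset K P)" by blast
  obtain m0 where m0: "\<And>m. m \<ge> m0 \<Longrightarrow> d m \<in> sumset K P"
    using d_near[OF P(1)] by (auto simp: eventually_sequentially)
  have "compact (closure (range d))" using d_bdd by (simp add: relatively_compact_def)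
  \<comment> \<open>The error \<open>d\<close> need not be small, but along late times it comes
    close to a bi-infinite trajectory \<open>h\<close>, which lies in \<open>K\<close> because
    \<open>d\<close> approaches \<open>K\<close>.\<close>
  then obtain h where h: "h \<in> bitraj R" and "range h \<subseteq> closure (range d)"
      and freq: "\<And>U. open U \<Longrightarrow> h \<in> U \<Longrightarrow> \<exists>\<^sub>F m in sequentially. (\<lambda>i. d (nat (int m + i))) \<in> U"
      and lim: "\<And>A. closed A \<Longrightarrow> eventually (\<lambda>m. d m \<in> A) sequentially \<Longrightarrow> range h \<subseteq> A"
    using traj_cluster[OF closed_R d closure_subset _ sequentially_bot order_refl] by blast
  have "range h \<subseteq> K" using lim[OF closed_thick d_near] inter by blast
  then have hK: "h i \<in> K" for i by blast
  have "\<exists>\<^sub>F m in sequentially. (\<lambda>i. d (nat (int m + i))) \<in> (\<Inter>j\<in>{..N}. {s. - h (int j) + s (int j) \<in> V})"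
  proof (rule freq)
    show "open (\<Inter>j\<in>{..N}. {s. - h (int j) + s (int j) \<in> V})"
      using V(2) by (intro open_INT ballI open_vimage_UNIV continuous_on_add continuous_on_const
          continuous_on_product_coordinates) auto
    show "h \<in> (\<Inter>j\<in>{..N}. {s. - h (int j) + s (int j) \<in> V})" using \<open>0 \<in> V\<close> by simp
  qed
  then have "\<exists>\<^sub>F m in sequentially. (\<lambda>i. d (nat (int m + i))) \<in> (\<Inter>j\<in>{..N}. {s. - h (int j) + s (int j) \<in> V})
      \<and> m \<ge> m0"
    by (rule frequently_eventually_frequently) (rule eventually_ge_at_top)
  then obtain m where m: "m \<ge> m0" "\<And>j. j \<le> N \<Longrightarrow> - h (int j) + d (m + j) \<in> V"
    by (auto dest!: frequently_ex simp: nat_int_add)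
  \<comment> \<open>Once \<open>h\<close> is subtracted, the first \<open>N + 1\<close> terms lie in
    \<open>V\<close>, as the factorization requires, and the trajectory stays in
    \<open>K + P\<close>.\<close>
  define g where "g = (\<lambda>j. - h (int j) + d (m + j))"
  have g: "g \<in> traj R"
    using traj_add[OF subgroup_R traj_uminus[OF subgroup_R] traj_shift[OF d]] bitraj_imp_traj[OF h, of 0]
    by (simp add: g_def)
  have "g j \<in> V" if "j \<le> N" for j using m(2)[OF that] by (simp add: g_def)
  moreover have "range g \<subseteq> sumset K P"
    using m0 m(1) thick_inv is_subgroupD(3)[OF K(2) hK] by (auto simp: g_def)
  ultimately obtain v where v: "v \<in> traj R" "range v \<subseteq> V" "g 0 - v 0 \<in> fwd (R\<inverse>) (V \<inter> K)" "\<And>j. g j - v j \<in> K"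
    using P(2) g unfolding factors_def by blast
  have c: "(\<lambda>j. g j - v j) \<in> traj R"
    using traj_add[OF subgroup_R g traj_uminus[OF subgroup_R v(1)]] by simp
  obtain b where b: "b \<in> traj (R\<inverse>)" "range b \<subseteq> V \<inter> K" "b 0 = g 0 - v 0"
    using v(3) by (rule fwdE)
  \<comment> \<open>The forward half \<open>g - v\<close> lies in \<open>K\<close>; since its first
    term is in \<open>fwd (R\<inverse>) (V \<inter> K)\<close>, it also has a past in
    \<open>V \<inter> K\<close>.\<close>
  obtain e0 where e0: "e0 \<in> bitraj R" "\<And>n. e0 (int n) = g n - v n" "\<And>n. e0 (- int n) = b n"
    using bitraj_glue[OF b(1) c b(3)] by metis
  have e0K: "e0 i \<in> K" for i
    using e0(2)[of "nat i"] e0(3)[of "nat (- i)"] v(4) b(2) by (cases "i \<ge> 0") auto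
  define e where "e = (\<lambda>i. h i + e0 i)"
  have e: "e \<in> bitraj R" unfolding e_def by (rule bitraj_add[OF subgroup_R h e0(1)])
  have eK: "e i \<in> K" for i unfolding e_def by (rule is_subgroupD(2)[OF K(2) hK e0K])
  have e_fwd: "e (int j) = d (m + j) - v j" for j
    by (simp add: e_def e0(2) g_def diff_conv_add_uminus add.assoc[symmetric] del: add_uminus_conv_diff)
  \<comment> \<open>The shift aligns time \<open>0\<close> of \<open>e\<close> with time
    \<open>m\<close> of \<open>x\<close>. Since \<open>e (int j) = d (m + j) - v j\<close>, the new
    error at time \<open>n \<ge> m\<close> is exactly \<open>v (n - m)\<close>.\<close>
  define y' where "y' = (\<lambda>i. y i + e (i + - int m))"
  have y': "y' \<in> bitraj R"
    unfolding y'_def by (rule bitraj_add[OF subgroup_R y(1) bitraj_shift[OF e]])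
  have y'_bdd: "relatively_compact (range y')"
    by (rule relatively_compact_sumset[OF y(2) relatively_compact_compact[OF K(1)]])
      (auto simp: y'_def intro!: sumsetI eK)
  define d' where "d' = (\<lambda>n. - y' (int n) + x n)"
  have d'_eq: "d' n = - e (int n - int m) + d n" for n
    by (simp add: d'_def y'_def d_def minus_add add.assoc[symmetric])
  have d': "d' \<in> traj R"
    using traj_add[OF subgroup_R traj_uminus[OF subgroup_R] x(1)] bitraj_imp_traj[OF y', of 0]
    by (simp add: d'_def)
  have d'_bdd: "relatively_compact (range d')"
    by (rule relatively_compact_sumset[OF relatively_compact_uminus[OF y'_bdd] x(2)])
      (auto simp: d'_def intro!: sumsetI)
  have d'_V: "d' n \<in> V" if "n \<ge> m" for n
  proof -
    have "d' n = - (d n - v (n - m)) + d n"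
      using e_fwd[of "n - m"] that by (simp add: d'_eq of_nat_diff)
    also have "\<dots> = v (n - m)" by simp
    finally show ?thesis using v(2) by auto
  qed
  define K' where "K' = bicore R (V \<inter> K)"
  have "tracks x K' y'"
    unfolding tracks_def
  proof (intro conjI allI impI)
    show "compact K'" unfolding K'_def using closed_R V(1) \<open>closed K\<close>
      by (intro compact_bicore compact_Int_closed)
    show "is_subgroup K'" unfolding K'_def using subgroup_R V(3) K(2)
      by (intro is_subgroup_bicore is_subgroup_Int)
    show "K' \<subseteq> bicore R K'"
    proof
      fix k assume "k \<in> K'"
      then obtain s where s: "s \<in> bitraj R" "range s \<subseteq> V \<inter> K" "s 0 = k"
        unfolding K'_def by (rule bicoreE)
      then have "range s \<subseteq> K'" unfolding K'_def using bicore_mem by blast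
      then show "k \<in> bicore R K'" using s bicore_mem by blast
    qed
    show "y' \<in> bitraj R" "relatively_compact (range y')" by fact+
    fix U :: "'a set" assume U: "open U" "0 \<in> U"
    have "\<forall>\<^sub>F n in sequentially. d' n \<in> sumset K' U"
      unfolding K'_def
    proof (rule tendsto_bicore[OF d' d'_bdd _ _ _ U, where \<A> = "insert V (sumset K ` \<O>)"])
      fix A assume A: "A \<in> insert V (sumset K ` \<O>)"
      then show "closed A" using V(1) closed_thick by (auto simp: compact_imp_closed)
      have "\<forall>\<^sub>F n in sequentially. d' n \<in> V"
        using d'_V unfolding eventually_sequentially by blast
      moreover have "\<forall>\<^sub>F n in sequentially. d' n \<in> sumset K P" if "P \<in> \<O>" for P
        using d_near[OF that]
      proof (rule eventually_mono)
        show "d' n \<in> sumset K P" if "d n \<in> sumset K P" for n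
          unfolding d'_eq by (rule thick_inv[OF is_subgroupD(3)[OF K(2) eK] that])
      qed
      ultimately show "\<forall>\<^sub>F n in sequentially. d' n \<in> A" using A by blast
    next
      show "\<Inter>(insert V (sumset K ` \<O>)) \<subseteq> V \<inter> K" using inter by auto
    qed
    then show "\<forall>\<^sub>F n in sequentially. - y' (int n) + x n \<in> sumset K' U" by (simp add: d'_def)
  qed
  moreover have "K' \<subseteq> V \<inter> K" by (auto simp: K'_def bicore_def)
  moreover have "- y i + y' i \<in> K" for i
    using eK by (simp add: y'_def add.assoc[symmetric])
  ultimately show ?thesis by blast
qed

text \<open>At a time when \<open>x\<close> is close to one of its bi-infinite cluster points, the
  past of the cluster point and the future of \<open>x\<close> can be joined after corrections in
  \<open>V\<close>. From then on the error lies in \<open>V\<close>, so \<open>bicore R V\<close>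
  serves as \<open>K\<close>.\<close>

lemma tracks_exists:
  assumes x: "x \<in> traj R" "relatively_compact (range x)"
  shows "\<exists>K y. tracks x K y"
proof -
  obtain V :: "'a set" where V: "compact V" "open V" "is_subgroup V"
    using small_subgroup[OF open_UNIV] by blast
  obtain W where W: "open W" "0 \<in> W"
    and factor: "\<And>w. w \<in> W \<Longrightarrow> \<exists>b\<in>fwd (R\<inverse>) V. \<exists>f\<in>fwd R V. w = b + f"
    using small_factor[OF V] by blast
  have "compact (closure (range x))" using x(2) by (simp add: relatively_compact_def)
  then obtain h where h: "h \<in> bitraj R" "range h \<subseteq> closure (range x)"
      and freq: "\<And>U. open U \<Longrightarrow> h \<in> U \<Longrightarrow> \<exists>\<^sub>F m in sequentially. (\<lambda>i. x (nat (int m + i))) \<in> U"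
    using traj_cluster[OF closed_R x(1) closure_subset _ sequentially_bot order_refl] by blast
  have "\<exists>\<^sub>F m in sequentially. (\<lambda>i. x (nat (int m + i))) \<in> {s. - h 0 + s 0 \<in> W}"
  proof (rule freq)
    show "open {s. - h 0 + s 0 \<in> W}"
      by (intro open_vimage_UNIV W(1) continuous_on_add continuous_on_const continuous_on_product_coordinates)
    show "h \<in> {s. - h 0 + s 0 \<in> W}" using W by simp
  qed
  then obtain n where "- h 0 + x n \<in> W" by (auto dest!: frequently_ex)
  then obtain b0 f0 where bf: "b0 \<in> fwd (R\<inverse>) V" "f0 \<in> fwd R V" "- h 0 + x n = b0 + f0"
    using factor by blast
  obtain b where b: "b \<in> traj (R\<inverse>)" "range b \<subseteq> V" "b 0 = b0" using bf(1) by (rule fwdE)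
  obtain f where f: "f \<in> traj R" "range f \<subseteq> V" "f 0 = f0" using bf(2) by (rule fwdE)
  have bwd: "(\<lambda>j. h (0 - int j) + b j) \<in> traj (R\<inverse>)"
    by (rule traj_add[OF is_subgroup_converse[OF subgroup_R] bitraj_imp_traj_converse[OF h(1)] b(1)])
  have forth: "(\<lambda>j. x (n + j) + - f j) \<in> traj R"
    by (rule traj_add[OF subgroup_R traj_shift[OF x(1)] traj_uminus[OF subgroup_R f(1)]])
  have "x n = h 0 + (b0 + f0)" unfolding bf(3)[symmetric] by (simp add: add.assoc[symmetric])
  then have start: "h (0 - int 0) + b 0 = x (n + 0) + - f 0"
    by (simp add: b(3) f(3) add.assoc[symmetric])
  \<comment> \<open>The factorization \<open>- h 0 + x n = b0 + f0\<close> says precisely that the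
    corrected halves agree at the origin: \<open>h 0 + b0 = x n - f0\<close>.\<close>
  obtain Y where Y: "Y \<in> bitraj R" "\<And>j. Y (int j) = x (n + j) - f j" "\<And>j. Y (- int j) = h (- int j) + b j"
    using bitraj_glue[OF bwd forth start] by auto
  define y where "y = (\<lambda>i. Y (i + - int n))"
  have y: "y \<in> bitraj R" unfolding y_def by (rule bitraj_shift[OF Y(1)])
  have "Y i \<in> sumset (closure (range x)) V" for i
  proof (cases "i \<ge> 0")
    case True
    then have "Y i = x (n + nat i) + - f (nat i)" using Y(2)[of "nat i"] by simp
    moreover have "x (n + nat i) \<in> closure (range x)" using closure_subset[of "range x"] by blast
    moreover have "- f (nat i) \<in> V" using f(2) by (intro is_subgroupD(3)[OF V(3)]) blast
    ultimately show ?thesis by (metis sumsetI)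
  next
    case False
    then have "Y i = h i + b (nat (- i))" using Y(3)[of "nat (- i)"] by simp
    then show ?thesis using h(2) b(2) by (auto intro!: sumsetI)
  qed
  then have y_bdd: "relatively_compact (range y)"
    using x(2) V(1) by (intro relatively_compact_subset[of "sumset (closure (range x)) V"] compact_sumset)
      (auto simp: y_def relatively_compact_def)
  define d where "d = (\<lambda>n. - y (int n) + x n)"
  have d: "d \<in> traj R"
    using traj_add[OF subgroup_R traj_uminus[OF subgroup_R] x(1)] bitraj_imp_traj[OF y, of 0]
    by (simp add: d_def)
  have d_bdd: "relatively_compact (range d)"
    by (rule relatively_compact_sumset[OF relatively_compact_uminus[OF y_bdd] x(2)])
      (auto simp: d_def intro!: sumsetI)
  have dV: "d m \<in> V" if "m \<ge> n" for m
  proof -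
    have "d m = f (m - n)"
      using Y(2)[of "m - n"] that by (simp add: d_def y_def of_nat_diff)
    then show ?thesis using f(2) by auto
  qed
  have "tracks x (bicore R V) y"
    unfolding tracks_def
  proof (intro conjI allI impI)
    show "compact (bicore R V)" using closed_R V(1) by (rule compact_bicore)
    show "is_subgroup (bicore R V)" using subgroup_R V(3) by (rule is_subgroup_bicore)
    show "bicore R V \<subseteq> bicore R (bicore R V)"
    proof
      fix k assume "k \<in> bicore R V"
      then obtain s where s: "s \<in> bitraj R" "range s \<subseteq> V" "s 0 = k" by (rule bicoreE)
      then have "range s \<subseteq> bicore R V" using bicore_mem by blast
      then show "k \<in> bicore R (bicore R V)" using s bicore_mem by blast
    qed
    show "y \<in> bitraj R" "relatively_compact (range y)" by fact+
    fix U :: "'a set" assume U: "open U" "0 \<in> U"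
    have "\<forall>\<^sub>F n in sequentially. d n \<in> sumset (bicore R V) U"
    proof (rule tendsto_bicore[OF d d_bdd _ _ _ U, where \<A> = "{V}"])
      show "closed A" if "A \<in> {V}" for A using that V(1) by (simp add: compact_imp_closed)
      show "\<forall>\<^sub>F n in sequentially. d n \<in> A" if "A \<in> {V}" for A
        using that dV unfolding eventually_sequentially by blast
    qed simp
    then show "\<forall>\<^sub>F n in sequentially. - y (int n) + x n \<in> sumset (bicore R V) U" by (simp add: d_def)
  qed
  then show ?thesis by blast
qed

text \<open>
  Ordering pairs \<open>(K, y)\<close> by inclusion of these sets of sequences turns Zorn's lemma for pairs into the one
  for sets.
\<close>

definition tube :: "'a set \<Rightarrow> (int \<Rightarrow> 'a) \<Rightarrow> (int \<Rightarrow> 'a) set" where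
  "tube K y = {s. \<forall>i. - y i + s i \<in> K}"

text \<open>A tube is the product of the left cosets \<open>y i + K\<close>. One such coset lies in
  another iff the subgroups are nested and the base points agree modulo the larger subgroup.\<close>

lemma tube_subset_iff:
  assumes "is_subgroup K" "is_subgroup K'"
  shows "tube K y \<subseteq> tube K' y' \<longleftrightarrow> K \<subseteq> K' \<and> (\<forall>i. - y' i + y i \<in> K')"
proof
  assume sub: "tube K y \<subseteq> tube K' y'"
  have "y \<in> tube K y" using is_subgroupD(1)[OF assms(1)] by (simp add: tube_def)
  then have "y \<in> tube K' y'" using sub by blast
  then have y: "\<forall>i. - y' i + y i \<in> K'" by (simp add: tube_def)
  have "k \<in> K'" if "k \<in> K" for k
  proof -
    have "(\<lambda>i. y i + k) \<in> tube K y" using that by (simp add: tube_def add.assoc[symmetric])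
    then have "(\<lambda>i. y i + k) \<in> tube K' y'" using sub by blast
    then have "- y' 0 + (y 0 + k) \<in> K'" by (simp add: tube_def)
    then have "- (- y' 0 + y 0) + (- y' 0 + (y 0 + k)) \<in> K'"
      using is_subgroupD(2)[OF assms(2) is_subgroupD(3)[OF assms(2) y[rule_format, of 0]]] by blast
    moreover have "- (- y' 0 + y 0) + (- y' 0 + (y 0 + k)) = k"
      by (metis add.assoc left_minus add_0)
    ultimately show ?thesis by simp
  qed
  then show "K \<subseteq> K' \<and> (\<forall>i. - y' i + y i \<in> K')" using y by blast
next
  assume *: "K \<subseteq> K' \<and> (\<forall>i. - y' i + y i \<in> K')"
  show "tube K y \<subseteq> tube K' y'"
  proof
    fix s assume "s \<in> tube K y"
    have "- y' i + s i \<in> K'" for i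
    proof -
      have "- y i + s i \<in> K'" using * \<open>s \<in> tube K y\<close> by (auto simp: tube_def)
      then have "(- y' i + y i) + (- y i + s i) \<in> K'"
        using * is_subgroupD(2)[OF assms(2)] by blast
      then show ?thesis by (simp only: add_cancel_middle)
    qed
    then show "s \<in> tube K' y'" by (simp add: tube_def)
  qed
qed

section \<open>Topology of tubes and of the set of bi-infinite trajectories\<close>

lemma compact_tube:
  assumes "compact K"
  shows "compact (tube K y)"
proof -
  have "tube K y = {s. \<forall>i. s i \<in> sumset {y i} K}"
  proof (intro set_eqI iffI)
    fix s assume "s \<in> tube K y"
    then have "y i + (- y i + s i) \<in> sumset {y i} K" for i by (intro sumsetI) (auto simp: tube_def)
    then show "s \<in> {s. \<forall>i. s i \<in> sumset {y i} K}" by (simp add: add.assoc[symmetric])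
  next
    fix s assume *: "s \<in> {s. \<forall>i. s i \<in> sumset {y i} K}"
    have "- y i + s i \<in> K" for i
    proof -
      obtain k where "k \<in> K" "s i = y i + k" using * by (auto simp: sumset_def)
      then show ?thesis by (simp add: add.assoc[symmetric])
    qed
    then show "s \<in> tube K y" by (simp add: tube_def)
  qed
  then show ?thesis using assms by (auto intro!: compact_fun_box compact_sumset)
qed

lemma closed_tube:
  assumes "closed K"
  shows "closed (tube K y)"
proof -
  have "tube K y = (\<Inter>i. {s. - y i + s i \<in> K})" by (auto simp: tube_def)
  then show ?thesis
    using assms by (auto intro!: closed_INT closed_vimage_UNIV continuous_on_add continuous_on_const
      continuous_on_product_coordinates)
qed

lemma closed_bitraj: "closed (bitraj R)"
proof -
  have "bitraj R = (\<Inter>i. {s. (s i, s (i + 1)) \<in> R})" by (auto simp: bitraj_def)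
  then show ?thesis
    by (auto intro!: closed_INT closed_vimage_UNIV closed_R continuous_on_Pair
      continuous_on_product_coordinates)
qed

text \<open>For fixed \<open>k\<close>, the bi-infinite trajectories in \<open>K\<close> with value
  \<open>k\<close> at \<open>0\<close> form a chain of nonempty closed sets as \<open>K\<close>
  varies, and compactness gives a common one.\<close>

lemma bicore_Inter_chain:
  assumes ne: "\<K> \<noteq> {}"
    and chain: "\<And>K L. K \<in> \<K> \<Longrightarrow> L \<in> \<K> \<Longrightarrow> K \<subseteq> L \<or> L \<subseteq> K"
    and K: "\<And>K. K \<in> \<K> \<Longrightarrow> compact K \<and> K \<subseteq> bicore R K"
  shows "\<Inter>\<K> \<subseteq> bicore R (\<Inter>\<K>)"
proof
  fix k assume k: "k \<in> \<Inter>\<K>"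
  obtain K0 where K0: "K0 \<in> \<K>" using ne by blast
  define A where "A = (\<lambda>K. bitraj R \<inter> {s. s 0 \<in> {k}} \<inter> (\<Inter>i. {s. s i \<in> K}))"
  have A_nonempty: "\<exists>s. s \<in> A K" if "K \<in> \<K>" for K
  proof -
    have "k \<in> bicore R K" using k K[OF that] that by blast
    then show ?thesis by (rule bicoreE) (auto simp: A_def)
  qed
  have "\<exists>s\<in>{s. \<forall>i. s i \<in> K0}. \<forall>K\<in>\<K>. s \<in> A K"
  proof (rule compact_directed_Inter[OF _ ne])
    show "compact {s::int \<Rightarrow> 'a. \<forall>i. s i \<in> K0}" using K[OF K0] by (intro compact_fun_box) simp
    fix K assume "K \<in> \<K>"
    show "closed (A K)"
      using K[OF \<open>K \<in> \<K>\<close>] unfolding A_def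
      by (intro closed_Int closed_INT ballI closed_bitraj closed_vimage_UNIV
          continuous_on_product_coordinates closed_singleton) (simp add: compact_imp_closed)
    consider "K0 \<subseteq> K" | "K \<subseteq> K0" using chain[OF K0 \<open>K \<in> \<K>\<close>] by blast
    then show "{s. \<forall>i. s i \<in> K0} \<inter> A K \<noteq> {}"
    proof cases
      case 1
      obtain s where "s \<in> A K0" using A_nonempty[OF K0] ..
      then have "s \<in> {s. \<forall>i. s i \<in> K0} \<inter> A K" using 1 by (auto simp: A_def)
      then show ?thesis by blast
    next
      case 2
      obtain s where "s \<in> A K" using A_nonempty[OF \<open>K \<in> \<K>\<close>] ..
      then have "s \<in> {s. \<forall>i. s i \<in> K0} \<inter> A K" using 2 by (auto simp: A_def)
      then show ?thesis by blast
    qed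
    fix L assume "L \<in> \<K>"
    have "A K \<subseteq> A L" if "K \<subseteq> L" for K L using that by (auto simp: A_def)
    then show "\<exists>M\<in>\<K>. A M \<subseteq> A K \<inter> A L"
      using chain[OF \<open>K \<in> \<K>\<close> \<open>L \<in> \<K>\<close>] \<open>K \<in> \<K>\<close> \<open>L \<in> \<K>\<close> by blast
  qed
  then obtain s where s: "\<And>K. K \<in> \<K> \<Longrightarrow> s \<in> A K" by blast
  have "s \<in> bitraj R" "s 0 = k" using s[OF K0] by (auto simp: A_def)
  moreover have "range s \<subseteq> \<Inter>\<K>" using s by (auto simp: A_def)
  ultimately show "k \<in> bicore R (\<Inter>\<K>)" using bicore_mem by blast
qed

lemma compact_chain_subset_open:
  fixes \<K> :: "'a set set"
  assumes ne: "\<K> \<noteq> {}"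
    and chain: "\<And>K L. K \<in> \<K> \<Longrightarrow> L \<in> \<K> \<Longrightarrow> K \<subseteq> L \<or> L \<subseteq> K"
    and K: "\<And>K. K \<in> \<K> \<Longrightarrow> compact K"
    and U: "open U" "\<Inter>\<K> \<subseteq> U"
  shows "\<exists>K\<in>\<K>. K \<subseteq> U"
proof (rule ccontr)
  assume contra: "\<not> ?thesis"
  obtain K0 where K0: "K0 \<in> \<K>" using ne by blast
  have "\<exists>p\<in>K0. \<forall>K\<in>\<K>. p \<in> K - U"
  proof (rule compact_directed_Inter[OF K[OF K0] ne])
    fix K assume "K \<in> \<K>"
    show "closed (K - U)" using K[OF \<open>K \<in> \<K>\<close>] U(1) by (intro closed_Diff compact_imp_closed)
    show "K0 \<inter> (K - U) \<noteq> {}"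
      using chain[OF K0 \<open>K \<in> \<K>\<close>] contra K0 \<open>K \<in> \<K>\<close> by blast
    show "\<exists>M\<in>\<K>. M - U \<subseteq> (K - U) \<inter> (L - U)" if "L \<in> \<K>" for L
      using chain[OF \<open>K \<in> \<K>\<close> that] \<open>K \<in> \<K>\<close> that by blast
  qed
  then show False using U(2) K0 by blast
qed

lemma compact_sumset_subset_open:
  fixes K U :: "'a set"
  assumes "compact K" "open U" "K \<subseteq> U"
  shows "\<exists>N. open N \<and> 0 \<in> N \<and> sumset K N \<subseteq> U"
proof -
  have "open {p. snd p + fst p \<in> U}" by (intro open_vimage_UNIV assms continuous_intros)
  moreover have "{0} \<times> K \<subseteq> {p. snd p + fst p \<in> U}" using assms by auto
  ultimately have "\<exists>N. 0 \<in> N \<and> open N \<and> N \<times> K \<subseteq> {p. snd p + fst p \<in> U}"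
    by (rule Elementary_Topology.tube_lemma[OF assms(1)])
  then obtain N where N: "0 \<in> N" "open N" "N \<times> K \<subseteq> {p. snd p + fst p \<in> U}" by (elim exE conjE)
  have "sumset K N \<subseteq> U"
  proof
    fix p assume "p \<in> sumset K N"
    then obtain k n where "k \<in> K" "n \<in> N" "p = k + n" by (rule sumsetE)
    then have "(n, k) \<in> {p. snd p + fst p \<in> U}" using N(3) by blast
    then show "p \<in> U" by (simp add: \<open>p = k + n\<close>)
  qed
  then show ?thesis using N by blast
qed

text \<open>The subgroup of the lower bound is the intersection of the chain, and its trajectory is
  a common point of all tubes, found by compactness.\<close>

lemma tracks_chain_lower_bound:
  assumes ne: "\<C> \<noteq> {}" and sub: "\<C> \<subseteq> {tube K y |K y. tracks x K y}"
    and chain: "\<And>A B. A \<in> \<C> \<Longrightarrow> B \<in> \<C> \<Longrightarrow> A \<subseteq> B \<or> B \<subseteq> A"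
  shows "\<exists>K y. tracks x K y \<and> (\<forall>A\<in>\<C>. tube K y \<subseteq> A)"
proof -
  define D where "D = {(K, y). tracks x K y \<and> tube K y \<in> \<C>}"
  define \<K> where "\<K> = fst ` D"
  have tr: "compact K" "is_subgroup K" "K \<subseteq> bicore R K" "y \<in> bitraj R" "relatively_compact (range y)"
    if "tracks x K y" for K y using that by (auto simp: tracks_def)
  have \<K>I: "\<exists>y. tracks x K y \<and> tube K y \<in> \<C>" if "K \<in> \<K>" for K
    using that by (auto simp: \<K>_def D_def)
  have member: "\<exists>K y. A = tube K y \<and> tracks x K y \<and> K \<in> \<K>" if "A \<in> \<C>" for A
  proof -
    obtain K y where "A = tube K y" "tracks x K y" using sub \<open>A \<in> \<C>\<close> by blast
    then show ?thesis using \<open>A \<in> \<C>\<close> unfolding \<K>_def D_def by force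
  qed
  have \<K>_ne: "\<K> \<noteq> {}" using ne member by blast
  have \<K>_chain: "K \<subseteq> L \<or> L \<subseteq> K" if KL: "K \<in> \<K>" "L \<in> \<K>" for K L
  proof -
    obtain y where y: "tracks x K y" "tube K y \<in> \<C>" using \<K>I[OF KL(1)] by blast
    obtain z where z: "tracks x L z" "tube L z \<in> \<C>" using \<K>I[OF KL(2)] by blast
    show ?thesis
      using chain[OF y(2) z(2)] tube_subset_iff[OF tr(2)[OF y(1)] tr(2)[OF z(1)]]
        tube_subset_iff[OF tr(2)[OF z(1)] tr(2)[OF y(1)]] by blast
  qed
  have \<K>_compact: "compact K" "is_subgroup K" "K \<subseteq> bicore R K" if "K \<in> \<K>" for K
    using \<K>I[OF that] tr by blast+
  have own: "\<exists>y\<in>bitraj R. y \<in> A" if A: "A \<in> \<C>" for A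
  proof -
    obtain K y where "A = tube K y" "tracks x K y" using member[OF A] by blast
    then show ?thesis using tr[of K y] is_subgroupD(1)[of K] by (intro bexI[of _ y]) (auto simp: tube_def)
  qed
  obtain A0 where A0: "A0 \<in> \<C>" using ne by blast
  \<comment> \<open>Each tube contains its own base trajectory, so even its intersection with the
    closed set \<open>bitraj R\<close> is nonempty.\<close>
  have "\<exists>s\<in>A0. \<forall>A\<in>\<C>. s \<in> A \<inter> bitraj R"
  proof (rule compact_directed_Inter[OF _ ne])
    obtain K y where "A0 = tube K y" "tracks x K y" using member[OF A0] by blast
    then show "compact A0" using tr(1) by (simp add: compact_tube)
    fix A assume A: "A \<in> \<C>"
    obtain K y where "A = tube K y" "tracks x K y" using member[OF A] by blast
    then show "closed (A \<inter> bitraj R)"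
      using tr(1) by (simp add: closed_tube closed_bitraj closed_Int compact_imp_closed)
    show "A0 \<inter> (A \<inter> bitraj R) \<noteq> {}" using chain[OF A0 A] own[OF A0] own[OF A] by blast
    show "\<exists>C\<in>\<C>. C \<inter> bitraj R \<subseteq> A \<inter> bitraj R \<inter> (B \<inter> bitraj R)" if "B \<in> \<C>" for B
      using chain[OF A that] A that by blast
  qed
  then obtain s where s: "\<And>A. A \<in> \<C> \<Longrightarrow> s \<in> A" "s \<in> bitraj R" using A0 by blast
  define L where "L = \<Inter>\<K>"
  have "is_subgroup L" using \<K>_compact(2) unfolding L_def is_subgroup_def by blast
  have L_compact: "compact L"
  proof -
    obtain K where "K \<in> \<K>" using \<K>_ne by blast
    moreover have "closed (\<Inter>\<K>)" using \<K>_compact(1) by (intro closed_Inter ballI compact_imp_closed)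
    ultimately have "compact (K \<inter> \<Inter>\<K>)" using \<K>_compact(1) by (intro compact_Int_closed)
    moreover have "K \<inter> \<Inter>\<K> = L" using \<open>K \<in> \<K>\<close> by (auto simp: L_def)
    ultimately show ?thesis by simp
  qed
  have lower: "tube L s \<subseteq> A" if A: "A \<in> \<C>" for A
  proof -
    obtain K y where Ky: "A = tube K y" "tracks x K y" "K \<in> \<K>" using member[OF A] by blast
    have "\<forall>i. - y i + s i \<in> K" using s(1)[OF A] by (simp add: Ky(1) tube_def)
    moreover have "L \<subseteq> K" using Ky(3) by (auto simp: L_def)
    ultimately show ?thesis unfolding Ky(1)
      using tube_subset_iff[OF \<open>is_subgroup L\<close> tr(2)[OF Ky(2)]] by blast
  qed
  have "tracks x L s"
    unfolding tracks_def
  proof (intro conjI allI impI)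
    show "compact L" "is_subgroup L" "s \<in> bitraj R" by fact+
    show "L \<subseteq> bicore R L"
      unfolding L_def by (rule bicore_Inter_chain[OF \<K>_ne \<K>_chain]) (use \<K>_compact in auto)
    show "relatively_compact (range s)"
    proof -
      obtain K y where Ky: "A0 = tube K y" "tracks x K y" using member[OF A0] by blast
      have "s i \<in> sumset (range y) K" for i
      proof -
        have "y i + (- y i + s i) \<in> sumset (range y) K"
          using s(1)[OF A0] by (intro sumsetI) (auto simp: Ky(1) tube_def)
        then show ?thesis by (simp add: add.assoc[symmetric])
      qed
      then show ?thesis
        using relatively_compact_sumset[OF tr(5)[OF Ky(2)] relatively_compact_compact[OF tr(1)[OF Ky(2)]]]
        by blast
    qed
    fix U :: "'a set" assume U: "open U" "0 \<in> U"
    have "l \<in> sumset L U" if "l \<in> L" for l using sumsetI[OF that U(2)] by simp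
    \<comment> \<open>Convergence to \<open>L\<close> reduces to convergence to one \<open>K\<close>
      of the chain: some \<open>K\<close> already lies in \<open>L + U\<close>, and so does a
      thickening \<open>K + N\<close>.\<close>
    then have "\<exists>K\<in>\<K>. K \<subseteq> sumset L U"
      using \<K>_compact(1) open_sumset[OF U(1)]
      by (intro compact_chain_subset_open[OF \<K>_ne \<K>_chain]) (auto simp: L_def)
    then obtain K where K: "K \<in> \<K>" "K \<subseteq> sumset L U" by blast
    then obtain y where y: "tracks x K y" "tube K y \<in> \<C>" using \<K>I by blast
    obtain N where N: "open N" "0 \<in> N" "sumset K N \<subseteq> sumset L U"
      using compact_sumset_subset_open[OF tr(1)[OF y(1)] open_sumset[OF U(1)] K(2)] by blast
    have "\<forall>\<^sub>F n in sequentially. - y (int n) + x n \<in> sumset K N"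
      using y(1) N(1,2) by (simp add: tracks_def)
    then show "\<forall>\<^sub>F n in sequentially. - s (int n) + x n \<in> sumset L U"
    proof (rule eventually_mono)
      fix n assume "- y (int n) + x n \<in> sumset K N"
      then obtain k u where ku: "k \<in> K" "u \<in> N" "- y (int n) + x n = k + u" by (rule sumsetE)
      have "- y (int n) + s (int n) \<in> K" using s(1)[OF y(2)] by (simp add: tube_def)
      \<comment> \<open>Replacing \<open>y\<close> by \<open>s\<close> multiplies the error on the
        left by an element of \<open>K\<close>, so it stays in \<open>K + N\<close>.\<close>
      then have "- (- y (int n) + s (int n)) + k \<in> K"
        using is_subgroupD[OF tr(2)[OF y(1)]] ku(1) by blast
      then have "- (- y (int n) + s (int n)) + k + u \<in> sumset L U"
        using ku(2) N(3) sumsetI by blast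
      moreover have "- (- y (int n) + s (int n)) + k + u
          = - (- y (int n) + s (int n)) + (- y (int n) + x n)" by (simp only: ku(3) add.assoc)
      moreover have "\<dots> = - s (int n) + x n"
        by (simp only: minus_add minus_minus add_cancel_middle)
      ultimately show "- s (int n) + x n \<in> sumset L U" by simp
    qed
  qed
  then show ?thesis using lower by blast
qed

theorem asymptotic_bitraj:
  assumes x: "x \<in> traj R" "relatively_compact (range x)"
  shows "\<exists>y\<in>bitraj R. relatively_compact (range y) \<and> (\<lambda>n. - y (int n) + x n) \<longlonglongrightarrow> 0"
proof -
  define \<A> where "\<A> = {tube K y |K y. tracks x K y}"
  \<comment> \<open>Zorn's lemma yields maximal sets; passing to complements turns a maximal set
    into a minimal tube.\<close>
  have "\<exists>M\<in>uminus ` \<A>. \<forall>X\<in>uminus ` \<A>. M \<subseteq> X \<longrightarrow> X = M"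
  proof (rule Zorn_Lemma2, intro ballI)
    fix \<C> assume C: "\<C> \<in> chains (uminus ` \<A>)"
    show "\<exists>U\<in>uminus ` \<A>. \<forall>X\<in>\<C>. X \<subseteq> U"
    proof (cases "\<C> = {}")
      case True
      then show ?thesis using tracks_exists[OF x] by (auto simp: \<A>_def)
    next
      case False
      have "uminus ` \<C> \<noteq> {}" using False by simp
      moreover have "uminus ` \<C> \<subseteq> {tube K y |K y. tracks x K y}"
        using chainsD2[OF C] by (force simp: \<A>_def)
      moreover have "A \<subseteq> B \<or> B \<subseteq> A" if "A \<in> uminus ` \<C>" "B \<in> uminus ` \<C>" for A B
        using that chainsD[OF C] by blast
      ultimately have "\<exists>K y. tracks x K y \<and> (\<forall>A\<in>uminus ` \<C>. tube K y \<subseteq> A)"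
        by (rule tracks_chain_lower_bound)
      then obtain K y where "tracks x K y" "\<forall>A\<in>uminus ` \<C>. tube K y \<subseteq> A" by blast
      then show ?thesis by (intro bexI[of _ "- tube K y"]) (auto simp: \<A>_def)
    qed
  qed
  then obtain M where M: "M \<in> \<A>" "\<And>X. X \<in> \<A> \<Longrightarrow> X \<subseteq> M \<Longrightarrow> X = M"
    by (auto simp: image_iff)
  obtain K y where Ky: "M = tube K y" "tracks x K y" using M(1) by (auto simp: \<A>_def)
  have K: "is_subgroup K" using Ky(2) by (simp add: tracks_def)
  \<comment> \<open>Refining the minimal pair cannot shrink its tube, so \<open>K\<close> equals the
    refined subgroup and lies in \<open>V\<close>. As \<open>V\<close> is arbitrary,
    \<open>K\<close> is trivial.\<close>
  have small: "K \<subseteq> V" if V: "compact V" "open V" "is_subgroup V" for V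
  proof -
    obtain K' y' where K'y': "tracks x K' y'" "K' \<subseteq> V \<inter> K" "\<forall>i. - y i + y' i \<in> K"
      using tracks_refine[OF x Ky(2) V] by blast
    have K': "is_subgroup K'" using K'y'(1) by (simp add: tracks_def)
    have "tube K' y' \<in> \<A>" using K'y'(1) by (auto simp: \<A>_def)
    moreover have "tube K' y' \<subseteq> M" unfolding Ky(1) tube_subset_iff[OF K' K] using K'y'(2,3) by blast
    ultimately have "tube K y \<subseteq> tube K' y'" using M(2) Ky(1) by blast
    then have "K \<subseteq> K'" unfolding tube_subset_iff[OF K K'] by blast
    then show ?thesis using K'y'(2) by blast
  qed
  have "k = 0" if "k \<in> K" for k
  proof (rule ccontr)
    assume "k \<noteq> 0"
    then have "open (- {k})" "0 \<in> - {k}" by auto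
    then obtain V where "compact V" "open V" "is_subgroup V" "V \<subseteq> - {k}"
      using small_subgroup by blast
    then show False using small that by blast
  qed
  then have K0: "K \<subseteq> {0}" by blast
  have "(\<lambda>n. - y (int n) + x n) \<longlonglongrightarrow> 0"
  proof (rule topological_tendstoI)
    fix U :: "'a set" assume U: "open U" "0 \<in> U"
    have "sumset K U \<subseteq> U" using K0 by (auto simp: sumset_def)
    moreover have "\<forall>\<^sub>F n in sequentially. - y (int n) + x n \<in> sumset K U"
      using Ky(2) U by (simp add: tracks_def)
    ultimately show "\<forall>\<^sub>F n in sequentially. - y (int n) + x n \<in> U"
      by (auto elim: eventually_mono)
  qed
  then show ?thesis using Ky(2) by (auto simp: tracks_def)
qed

end

section \<open>Contraction and parabolic subgroups of a relation\<close>

text \<open>For the graph of \<open>\<alpha>\<close>, \<open>contr\<close> and \<open>parab\<close>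
  are \<open>con \<alpha>\<close> and \<open>par \<alpha>\<close>; for its converse they are
  \<open>con_minus \<alpha>\<close> and \<open>par_minus \<alpha>\<close>.\<close>

definition contr :: "('a::topological_group_add \<times> 'a) set \<Rightarrow> 'a set" where
  "contr R = {s 0 |s. s \<in> traj R \<and> s \<longlonglongrightarrow> 0}"

definition parab :: "('a::topological_group_add \<times> 'a) set \<Rightarrow> 'a set" where
  "parab R = {s 0 |s. s \<in> traj R \<and> relatively_compact (range s)}"

lemma parabI: "s \<in> traj R \<Longrightarrow> relatively_compact (range s) \<Longrightarrow> s 0 = x \<Longrightarrow> x \<in> parab R"
  by (auto simp: parab_def)

lemma contrI: "s \<in> traj R \<Longrightarrow> s \<longlonglongrightarrow> 0 \<Longrightarrow> s 0 = x \<Longrightarrow> x \<in> contr R"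
  by (auto simp: contr_def)

lemma parabE:
  assumes "x \<in> parab R"
  obtains s where "s \<in> traj R" "relatively_compact (range s)" "s 0 = x"
  using assms by (auto simp: parab_def)

lemma contrE:
  assumes "x \<in> contr R"
  obtains s where "s \<in> traj R" "s \<longlonglongrightarrow> 0" "s 0 = x"
  using assms by (auto simp: contr_def)

lemma compact_null_sequence:
  fixes s :: "nat \<Rightarrow> 'a::topological_group_add"
  assumes "s \<longlonglongrightarrow> 0"
  shows "compact (insert 0 (range s))"
proof (rule compactI)
  fix \<C> assume op: "\<forall>t\<in>\<C>. open t" and cover: "insert 0 (range s) \<subseteq> \<Union>\<C>"
  obtain T where T: "T \<in> \<C>" "0 \<in> T" using cover by blast
  have "\<forall>\<^sub>F n in sequentially. s n \<in> T"
    using assms T op by (intro topological_tendstoD) auto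
  then obtain N where N: "\<And>n. n \<ge> N \<Longrightarrow> s n \<in> T" by (auto simp: eventually_sequentially)
  have "\<forall>n. \<exists>C\<in>\<C>. s n \<in> C" using cover by blast
  then obtain c where c: "\<And>n. c n \<in> \<C>" "\<And>n. s n \<in> c n" by metis
  have "insert 0 (range s) \<subseteq> \<Union>(insert T (c ` {..<N}))"
  proof
    fix p assume "p \<in> insert 0 (range s)"
    then consider "p = 0" | n where "p = s n" "n < N" | n where "p = s n" "n \<ge> N"
      by (metis insertE rangeE not_le)
    then show "p \<in> \<Union>(insert T (c ` {..<N}))" using T(2) c(2) N by cases auto
  qed
  then show "\<exists>C'\<subseteq>\<C>. finite C' \<and> insert 0 (range s) \<subseteq> \<Union>C'"
    using T(1) c(1) by (intro exI[of _ "insert T (c ` {..<N})"]) auto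
qed

lemma contr_subset_parab:
  fixes R :: "('a::{topological_group_add, t2_space} \<times> 'a) set"
  shows "contr R \<subseteq> parab R"
proof
  fix x assume "x \<in> contr R"
  then obtain s where s: "s \<in> traj R" "s \<longlonglongrightarrow> 0" "s 0 = x" by (rule contrE)
  have "relatively_compact (range s)"
    using compact_null_sequence[OF s(2)] by (rule relatively_compact_subset) auto
  then show "x \<in> parab R" using s by (intro parabI)
qed

lemma is_subgroup_parab:
  fixes R :: "('a::{topological_group_add, t2_space} \<times> 'a) set"
  assumes R: "is_subgroup R"
  shows "is_subgroup (parab R)"
  unfolding is_subgroup_def
proof (intro conjI ballI)
  have "relatively_compact (range (\<lambda>_::nat. 0::'a))" by (rule relatively_compact_compact) simp
  then show "0 \<in> parab R" using zero_traj[OF R] by (intro parabI[of "\<lambda>_. 0"]) auto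
next
  fix x y assume xy: "x \<in> parab R" "y \<in> parab R"
  obtain s where s: "s \<in> traj R" "relatively_compact (range s)" "s 0 = x" using xy(1) by (rule parabE)
  obtain t where t: "t \<in> traj R" "relatively_compact (range t)" "t 0 = y" using xy(2) by (rule parabE)
  have "relatively_compact (range (\<lambda>n. s n + t n))"
    by (rule relatively_compact_sumset[OF s(2) t(2)]) (auto intro!: sumsetI)
  then show "x + y \<in> parab R"
    using traj_add[OF R s(1) t(1)] s(3) t(3) by (intro parabI[of "\<lambda>n. s n + t n"]) auto
next
  fix x assume "x \<in> parab R"
  then obtain s where s: "s \<in> traj R" "relatively_compact (range s)" "s 0 = x" by (rule parabE)
  have "relatively_compact (range (\<lambda>n. - s n))"
    using relatively_compact_uminus[OF s(2)] by (simp add: image_image)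
  then show "- x \<in> parab R" using traj_uminus[OF R s(1)] s(3) by (intro parabI[of "\<lambda>n. - s n"]) auto
qed

text \<open>Conjugation by elements of the compact closure of a bounded trajectory is equicontinuous
  at \<open>0\<close>, so it preserves convergence to \<open>0\<close>. This moves contracting parts
  past elements of \<open>lev \<alpha>\<close>.\<close>

lemma parab_normalizes_contr:
  fixes R :: "('a::{topological_group_add, t2_space} \<times> 'a) set"
  assumes R: "is_subgroup R" and "x \<in> parab R" "c \<in> contr R"
  shows "x + c - x \<in> contr R"
proof -
  obtain s where s: "s \<in> traj R" "relatively_compact (range s)" "s 0 = x"
    using assms(2) by (rule parabE)
  obtain t where t: "t \<in> traj R" "t \<longlonglongrightarrow> 0" "t 0 = c" using assms(3) by (rule contrE)
  have "(\<lambda>n. s n + t n + - s n) \<longlonglongrightarrow> 0"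
  proof (rule topological_tendstoI)
    fix U :: "'a set" assume U: "open U" "0 \<in> U"
    let ?W = "{p. snd p + fst p + - snd p \<in> U}"
    have "compact (closure (range s))" using s(2) by (simp add: relatively_compact_def)
    moreover have "open ?W" by (intro open_vimage_UNIV U continuous_intros)
    moreover have "{0} \<times> closure (range s) \<subseteq> ?W" using U by auto
    ultimately have "\<exists>N. 0 \<in> N \<and> open N \<and> N \<times> closure (range s) \<subseteq> ?W"
      by (rule Elementary_Topology.tube_lemma)
    then obtain N where N: "0 \<in> N" "open N" "N \<times> closure (range s) \<subseteq> ?W" by (elim exE conjE)
    have "s n + t n + - s n \<in> U" if "t n \<in> N" for n
    proof -
      have "s n \<in> closure (range s)" using closure_subset[of "range s"] by blast
      then have "(t n, s n) \<in> ?W" using N(3) that by blast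
      then show ?thesis by simp
    qed
    moreover have "\<forall>\<^sub>F n in sequentially. t n \<in> N" using t(2) N by (intro topological_tendstoD)
    ultimately show "\<forall>\<^sub>F n in sequentially. s n + t n + - s n \<in> U" by (auto elim: eventually_mono)
  qed
  moreover have "(\<lambda>n. s n + t n + - s n) \<in> traj R"
    by (rule traj_add[OF R traj_add[OF R s(1) t(1)] traj_uminus[OF R s(1)]])
  ultimately show ?thesis
    using s(3) t(3) by (intro contrI[of "\<lambda>n. s n + t n + - s n"]) auto
qed

lemma fwd_subset_parab:
  fixes R :: "('a::{topological_group_add, t2_space} \<times> 'a) set"
  assumes "compact V"
  shows "fwd R V \<subseteq> parab R"
  unfolding fwd_def parab_def using relatively_compact_subset[OF assms] by blast

text \<open>The asymptotic bi-infinite trajectory is bounded in both directions of time, which makes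
  its term at \<open>0\<close> the Levi part; the remaining error is contracted.\<close>

lemma (in tdlc_relation) parab_decomposition:
  assumes "x \<in> parab R"
  obtains l c where "l \<in> parab R \<inter> parab (R\<inverse>)" "c \<in> contr R" "x = l + c"
proof -
  obtain s where s: "s \<in> traj R" "relatively_compact (range s)" "s 0 = x" using assms by (rule parabE)
  obtain y where y: "y \<in> bitraj R" "relatively_compact (range y)" "(\<lambda>n. - y (int n) + s n) \<longlonglongrightarrow> 0"
    using asymptotic_bitraj[OF s(1,2)] by blast
  have half: "relatively_compact (range (\<lambda>n. y (f n)))" for f :: "nat \<Rightarrow> int"
  proof (rule relatively_compact_subset)
    show "compact (closure (range y))" using y(2) by (simp add: relatively_compact_def)
    show "range (\<lambda>n. y (f n)) \<subseteq> closure (range y)" using closure_subset[of "range y"] by blast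
  qed
  have fw: "(\<lambda>n. y (int n)) \<in> traj R" using bitraj_imp_traj[OF y(1), of 0] by simp
  have "y 0 \<in> parab R" by (rule parabI[OF fw half]) simp
  moreover have "y 0 \<in> parab (R\<inverse>)"
    by (rule parabI[OF bitraj_imp_traj_converse[OF y(1), of 0] half]) simp
  moreover have "- y 0 + s 0 \<in> contr R"
    by (rule contrI[OF traj_add[OF subgroup_R traj_uminus[OF subgroup_R fw] s(1)] y(3)]) simp
  moreover have "x = y 0 + (- y 0 + s 0)" using s(3) by (simp add: add.assoc[symmetric])
  ultimately show ?thesis using that by simp
qed

section \<open>The graph of a continuous endomorphism\<close>

definition graph :: "('a \<Rightarrow> 'b) \<Rightarrow> ('a \<times> 'b) set" where
  "graph f = {(x, y). f x = y}"

lemma traj_graph_iff: "s \<in> traj (graph f) \<longleftrightarrow> (\<forall>n. s n = (f ^^ n) (s 0))"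
proof
  assume s: "s \<in> traj (graph f)"
  have "s n = (f ^^ n) (s 0)" for n
  proof (induction n)
    case (Suc n)
    have "f (s n) = s (Suc n)" using s by (simp add: traj_def graph_def)
    then show ?case using Suc by simp
  qed simp
  then show "\<forall>n. s n = (f ^^ n) (s 0)" ..
next
  assume s: "\<forall>n. s n = (f ^^ n) (s 0)"
  have "s (Suc n) = f (s n)" for n using s[rule_format, of "Suc n"] s[rule_format, of n] by simp
  then show "s \<in> traj (graph f)" by (simp add: traj_def graph_def)
qed

lemma orbit_traj: "(\<lambda>n. (f ^^ n) x) \<in> traj (graph f)"
  by (simp add: traj_graph_iff)

lemma regressive_trajectory_iff:
  "regressive_trajectory \<alpha> x s \<longleftrightarrow> s \<in> traj ((graph \<alpha>)\<inverse>) \<and> s 0 = x"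
  by (simp add: regressive_trajectory_def traj_def graph_def conj_commute)

lemma par_eq_parab: "par \<alpha> = parab (graph \<alpha>)"
proof (intro set_eqI iffI)
  fix x assume "x \<in> par \<alpha>"
  then show "x \<in> parab (graph \<alpha>)"
    by (intro parabI[OF orbit_traj]) (auto simp: par_def)
next
  fix x assume "x \<in> parab (graph \<alpha>)"
  then obtain s where s: "s \<in> traj (graph \<alpha>)" "relatively_compact (range s)" "s 0 = x" by (rule parabE)
  then have "s = (\<lambda>n. (\<alpha> ^^ n) x)" by (auto simp: traj_graph_iff)
  then show "x \<in> par \<alpha>" using s(2) by (simp add: par_def)
qed

lemma con_eq_contr: "con \<alpha> = contr (graph \<alpha>)"
proof (intro set_eqI iffI)
  fix x assume "x \<in> con \<alpha>"
  then show "x \<in> contr (graph \<alpha>)"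
    by (intro contrI[OF orbit_traj]) (auto simp: con_def)
next
  fix x assume "x \<in> contr (graph \<alpha>)"
  then obtain s where s: "s \<in> traj (graph \<alpha>)" "s \<longlonglongrightarrow> 0" "s 0 = x" by (rule contrE)
  then have "s = (\<lambda>n. (\<alpha> ^^ n) x)" by (auto simp: traj_graph_iff)
  then show "x \<in> con \<alpha>" using s(2) by (simp add: con_def)
qed

lemma par_minus_eq_parab: "par_minus \<alpha> = parab ((graph \<alpha>)\<inverse>)"
  by (auto simp: par_minus_def parab_def regressive_trajectory_iff)

lemma con_minus_eq_contr: "con_minus \<alpha> = contr ((graph \<alpha>)\<inverse>)"
  by (auto simp: con_minus_def contr_def regressive_trajectory_iff)

lemma continuous_endomorphism_graph:
  fixes \<alpha> :: "'a::{topological_group_add, t2_space} \<Rightarrow> 'a"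
  assumes "continuous_endomorphism \<alpha>"
  shows "closed (graph \<alpha>)" "is_subgroup (graph \<alpha>)"
proof -
  have cont: "continuous_on UNIV \<alpha>" and add: "\<And>x y. \<alpha> (x + y) = \<alpha> x + \<alpha> y"
    using assms by (auto simp: continuous_endomorphism_def)
  have "closed {p. \<alpha> (fst p) = snd p}"
    by (intro closed_Collect_eq continuous_on_compose2[OF cont] continuous_intros) auto
  also have "{p. \<alpha> (fst p) = snd p} = graph \<alpha>" by (auto simp: graph_def)
  finally show "closed (graph \<alpha>)" .
  have zero: "\<alpha> 0 = 0" using add[of 0 0] by (metis add.right_neutral add_left_imp_eq)
  have "\<alpha> (- x) = - \<alpha> x" for x
    using add[of "- x" x] zero by (simp add: eq_neg_iff_add_eq_0)
  then show "is_subgroup (graph \<alpha>)"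
    using zero add by (auto simp: is_subgroup_def graph_def zero_prod_def)
qed

text \<open>The factorization with \<open>K = UNIV\<close> restricts only finitely many iterates of
  a point, so by continuity it applies on a whole neighbourhood of \<open>0\<close>.\<close>

lemma graph_small_factor:
  fixes \<alpha> :: "'a::{topological_group_add, t2_space} \<Rightarrow> 'a"
  assumes \<alpha>: "continuous_endomorphism \<alpha>" and V: "compact V" "open V" "is_subgroup V"
  shows "\<exists>W. open W \<and> 0 \<in> W \<and>
    (\<forall>w\<in>W. \<exists>b\<in>fwd ((graph \<alpha>)\<inverse>) V. \<exists>f\<in>fwd (graph \<alpha>) V. w = b + f)"
proof -
  have cont: "continuous_on UNIV \<alpha>" using \<alpha> by (simp add: continuous_endomorphism_def)
  note R = continuous_endomorphism_graph[OF \<alpha>]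
  have "\<exists>N. \<exists>S\<in>{UNIV}. \<forall>g\<in>traj (graph \<alpha>). range g \<subseteq> S \<longrightarrow> (\<forall>j\<le>N. g j \<in> V) \<longrightarrow>
    (\<exists>h\<in>traj (graph \<alpha>). range h \<subseteq> V \<and> g 0 - h 0 \<in> fwd ((graph \<alpha>)\<inverse>) (V \<inter> UNIV) \<and> (\<forall>j. g j - h j \<in> UNIV))"
  proof (rule tidy_factorization[OF R V(1,3,2), where Q = "\<alpha> ` V"])
    show "compact (\<alpha> ` V)" using continuous_on_subset[OF cont] V(1) by (intro compact_continuous_image) auto
  qed (auto simp: is_subgroup_UNIV graph_def)
  then obtain N where N: "\<And>g. g \<in> traj (graph \<alpha>) \<Longrightarrow> (\<And>j. j \<le> N \<Longrightarrow> g j \<in> V) \<Longrightarrow>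
    \<exists>h\<in>traj (graph \<alpha>). range h \<subseteq> V \<and> g 0 - h 0 \<in> fwd ((graph \<alpha>)\<inverse>) V"
    by (simp add: Ball_def) blast
  define W where "W = (\<Inter>j\<in>{..N}. {w. (\<alpha> ^^ j) w \<in> V})"
  have cont_pow: "continuous_on UNIV (\<alpha> ^^ j)" for j
  proof (induction j)
    case (Suc j)
    then show ?case using continuous_on_compose[OF Suc continuous_on_subset[OF cont]] by simp
  qed (simp add: continuous_on_id)
  have "open W" unfolding W_def
    using V(2) cont_pow by (intro open_INT ballI open_vimage_UNIV) auto
  moreover have "0 \<in> W"
  proof -
    have "(\<lambda>_. 0) \<in> traj (graph \<alpha>)" by (rule zero_traj[OF R(2)])
    then have "(\<alpha> ^^ j) 0 = 0" for j unfolding traj_graph_iff by metis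
    then show ?thesis using is_subgroupD(1)[OF V(3)] by (simp add: W_def)
  qed
  moreover have "\<exists>b\<in>fwd ((graph \<alpha>)\<inverse>) V. \<exists>f\<in>fwd (graph \<alpha>) V. w = b + f" if "w \<in> W" for w
  proof -
    have "\<exists>h\<in>traj (graph \<alpha>). range h \<subseteq> V \<and> (\<alpha> ^^ 0) w - h 0 \<in> fwd ((graph \<alpha>)\<inverse>) V"
      by (rule N[OF orbit_traj]) (use that in \<open>auto simp: W_def\<close>)
    then obtain h where h: "h \<in> traj (graph \<alpha>)" "range h \<subseteq> V" "w - h 0 \<in> fwd ((graph \<alpha>)\<inverse>) V"
      by auto
    then have "h 0 \<in> fwd (graph \<alpha>) V" by (auto simp: fwd_def)
    then show ?thesis using h(3) by (intro bexI[of _ "w - h 0"] bexI[of _ "h 0"]) auto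
  qed
  ultimately show ?thesis by blast
qed

text \<open>Inversion swaps the two summands, and both sets of starting points are
  subgroups.\<close>

lemma converse_small_factor:
  fixes V :: "'a::topological_group_add set"
  assumes R: "is_subgroup R" and V: "is_subgroup V"
    and W: "open W" "0 \<in> W" "\<And>w. w \<in> W \<Longrightarrow> \<exists>b\<in>fwd (R\<inverse>) V. \<exists>f\<in>fwd R V. w = b + f"
  shows "\<exists>W. open W \<and> 0 \<in> W \<and> (\<forall>w\<in>W. \<exists>b\<in>fwd R V. \<exists>f\<in>fwd (R\<inverse>) V. w = b + f)"
proof (intro exI[of _ "{w. - w \<in> W}"] conjI ballI)
  show "open {w. - w \<in> W}" by (intro open_vimage_UNIV W continuous_intros)
  show "0 \<in> {w. - w \<in> W}" using W by simp
  fix w assume "w \<in> {w. - w \<in> W}"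
  then obtain b f where bf: "b \<in> fwd (R\<inverse>) V" "f \<in> fwd R V" "- w = b + f" using W(3) by blast
  have "w = - f + - b" using bf(3) by (metis minus_add minus_minus)
  then show "\<exists>b\<in>fwd R V. \<exists>f\<in>fwd (R\<inverse>) V. w = b + f"
    using is_subgroupD(3)[OF is_subgroup_fwd[OF is_subgroup_converse[OF R] V] bf(1)]
      is_subgroupD(3)[OF is_subgroup_fwd[OF R V] bf(2)] by blast
qed

section \<open>The product map from \<open>par \<alpha> \<times> par_minus \<alpha>\<close>\<close>

theorem proposition1p1:
  fixes \<alpha> :: "'a::{topological_group_add, t2_space} \<Rightarrow> 'a"
  assumes "locally_compact_space (euclidean :: 'a topology)"
    and "totally_disconnected (UNIV :: 'a set)"
    and "continuous_endomorphism \<alpha>"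
  shows "open (Omega \<alpha>) \<and>
         0 \<in> Omega \<alpha> \<and>
         \<alpha> ` Omega \<alpha> \<subseteq> Omega \<alpha> \<and>
         continuous_map (prod_topology (top_of_set (par \<alpha>)) (top_of_set (par_minus \<alpha>)))
           (top_of_set (Omega \<alpha>)) (\<lambda>(x, y). x + y) \<and>
         (\<lambda>(x, y). x + y) ` (par \<alpha> \<times> par_minus \<alpha>) = Omega \<alpha> \<and>
         open_map (prod_topology (top_of_set (par \<alpha>)) (top_of_set (par_minus \<alpha>)))
           (top_of_set (Omega \<alpha>)) (\<lambda>(x, y). x + y)"
proof -
  note R = continuous_endomorphism_graph[OF assms(3)]
  have vd: "\<exists>H. compact H \<and> open H \<and> is_subgroup H \<and> H \<subseteq> N" if "open N" "0 \<in> N" for N :: "'a set"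
    using van_Dantzig[OF assms(1,2) that] by blast
  have back_factor: "\<exists>W. open W \<and> 0 \<in> W \<and>
      (\<forall>w\<in>W. \<exists>b\<in>fwd (graph \<alpha>) V. \<exists>f\<in>fwd ((graph \<alpha>)\<inverse>) V. w = b + f)"
    if V: "compact V" "open V" "is_subgroup V" for V
    using graph_small_factor[OF assms(3) V] converse_small_factor[OF R(2) V(3)] by blast
  interpret G: tdlc_relation "graph \<alpha>"
    by unfold_locales (fact R vd graph_small_factor[OF assms(3)])+
  interpret C: tdlc_relation "(graph \<alpha>)\<inverse>"
    by unfold_locales
      (use closed_converse[OF R(1)] is_subgroup_converse[OF R(2)] vd back_factor in auto)
  have par: "is_subgroup (par \<alpha>)" unfolding par_eq_parab by (rule is_subgroup_parab[OF R(2)])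
  have par_minus: "is_subgroup (par_minus \<alpha>)"
    unfolding par_minus_eq_parab by (rule is_subgroup_parab[OF C.subgroup_R])
  have Omega: "Omega \<alpha> = sumset (par \<alpha>) (par_minus \<alpha>)"
  proof (intro set_eqI iffI)
    fix p assume "p \<in> Omega \<alpha>"
    then obtain x y z where xyz: "x \<in> con \<alpha>" "y \<in> lev \<alpha>" "z \<in> con_minus \<alpha>" "p = x + y + z"
      by (auto simp: Omega_def)
    have "x \<in> par \<alpha>" "z \<in> par_minus \<alpha>"
      using xyz contr_subset_parab by (auto simp: con_eq_contr con_minus_eq_contr par_eq_parab par_minus_eq_parab)
    then show "p \<in> sumset (par \<alpha>) (par_minus \<alpha>)"
      using xyz(2,4) is_subgroupD(2)[OF par_minus] by (auto simp: add.assoc lev_def intro!: sumsetI)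
  next
    fix p assume "p \<in> sumset (par \<alpha>) (par_minus \<alpha>)"
    then obtain a b where ab: "a \<in> par \<alpha>" "b \<in> par_minus \<alpha>" "p = a + b" by (rule sumsetE)
    obtain l c where lc: "l \<in> lev \<alpha>" "c \<in> con \<alpha>" "a = l + c"
      using ab(1) by (auto simp: par_eq_parab par_minus_eq_parab con_eq_contr lev_def elim: G.parab_decomposition)
    obtain m d where md: "m \<in> lev \<alpha>" "d \<in> con_minus \<alpha>" "b = m + d"
      using ab(2) by (auto simp: par_eq_parab par_minus_eq_parab con_minus_eq_contr lev_def elim: C.parab_decomposition)
    \<comment> \<open>The decompositions give \<open>p = l + c + m + d\<close> with \<open>l\<close>
      in front of \<open>c\<close>; conjugating \<open>c\<close> by \<open>l\<close> brings the
      contracting part to the left and joins \<open>l\<close> and \<open>m\<close>.\<close>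
    have "l + c - l \<in> con \<alpha>"
      using lc parab_normalizes_contr[OF R(2)] by (auto simp: lev_def par_eq_parab con_eq_contr)
    moreover have "l + m \<in> lev \<alpha>"
      using lc(1) md(1) is_subgroupD(2)[OF par] is_subgroupD(2)[OF par_minus] by (auto simp: lev_def)
    moreover have "p = (l + c - l) + (l + m) + d"
      by (simp add: ab(3) lc(3) md(3) add.assoc[symmetric])
    ultimately show "p \<in> Omega \<alpha>" using md(2) unfolding Omega_def by blast
  qed
  have invariant: "\<alpha> ` Omega \<alpha> \<subseteq> Omega \<alpha>"
  proof -
    have "\<alpha> a \<in> par \<alpha>" if a: "a \<in> par \<alpha>" for a
    proof -
      obtain s where s: "s \<in> traj (graph \<alpha>)" "relatively_compact (range s)" "s 0 = a"
        using a unfolding par_eq_parab by (rule parabE)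
      have "relatively_compact (range (\<lambda>n. s (1 + n)))"
        using s(2) closure_subset[of "range s"] unfolding relatively_compact_def[of "range s"]
        by (rule_tac relatively_compact_subset) auto
      moreover have "(s 0, s (Suc 0)) \<in> graph \<alpha>" using s(1) by (simp add: traj_def)
      then have "\<alpha> a = s (1 + 0)" using s(3) by (simp add: graph_def)
      ultimately show ?thesis
        unfolding par_eq_parab by (intro parabI[OF traj_shift[OF s(1), of 1]]) simp_all
    qed
    moreover have "\<alpha> b \<in> par_minus \<alpha>" if b: "b \<in> par_minus \<alpha>" for b
    proof -
      obtain s where s: "s \<in> traj ((graph \<alpha>)\<inverse>)" "relatively_compact (range s)" "s 0 = b"
        using b unfolding par_minus_eq_parab by (rule parabE)
      \<comment> \<open>Prepending \<open>\<alpha> b\<close> to a regressive trajectory of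
        \<open>b\<close> gives one of \<open>\<alpha> b\<close>, and adds a single point to its
        range.\<close>
      define t where "t = (\<lambda>n. case n of 0 \<Rightarrow> \<alpha> b | Suc m \<Rightarrow> s m)"
      have "regressive_trajectory \<alpha> b s" using s by (simp add: regressive_trajectory_iff)
      then have "\<alpha> (t (Suc n)) = t n" for n
        by (cases n) (simp_all add: regressive_trajectory_def t_def)
      then have "regressive_trajectory \<alpha> (t 0) t" by (simp add: regressive_trajectory_def)
      then have "t \<in> traj ((graph \<alpha>)\<inverse>)" by (simp add: regressive_trajectory_iff)
      moreover have "relatively_compact (range t)"
      proof (rule relatively_compact_subset)
        show "compact (insert (\<alpha> b) (closure (range s)))"
          using s(2) by (intro compact_insert) (simp add: relatively_compact_def)
        have "t n \<in> insert (\<alpha> b) (closure (range s))" for n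
          using closure_subset[of "range s"] by (cases n) (auto simp: t_def)
        then show "range t \<subseteq> insert (\<alpha> b) (closure (range s))" by blast
      qed
      ultimately show ?thesis unfolding par_minus_eq_parab by (rule parabI) (simp add: t_def)
    qed
    moreover have "\<alpha> (a + b) = \<alpha> a + \<alpha> b" for a b
      using assms(3) by (simp add: continuous_endomorphism_def)
    ultimately show ?thesis unfolding Omega by (auto simp: intro!: sumsetI elim!: sumsetE)
  qed
  have image: "(\<lambda>(x, y). x + y) ` (par \<alpha> \<times> par_minus \<alpha>) = Omega \<alpha>"
    unfolding Omega by (force simp: sumset_def)
  \<comment> \<open>The image is open in the whole group, which also gives openness of
    \<open>Omega \<alpha>\<close> as the image of the full product.\<close>
  have open_image: "open ((\<lambda>(x, y). x + y) ` U)"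
    if U: "openin (prod_topology (top_of_set (par \<alpha>)) (top_of_set (par_minus \<alpha>))) U" for U
  proof (subst open_subopen, intro ballI)
    fix p assume "p \<in> (\<lambda>(x, y). x + y) ` U"
    then obtain x y where xy: "(x, y) \<in> U" "p = x + y" by auto
    obtain A B where AB: "openin (top_of_set (par \<alpha>)) A" "openin (top_of_set (par_minus \<alpha>)) B"
        "x \<in> A" "y \<in> B" "A \<times> B \<subseteq> U"
      using U xy(1) unfolding openin_prod_topology_alt by meson
    obtain A' where A': "open A'" "A = par \<alpha> \<inter> A'" using AB(1) by (auto simp: openin_open)
    obtain B' where B': "open B'" "B = par_minus \<alpha> \<inter> B'" using AB(2) by (auto simp: openin_open)
    have "open ({v. x + v \<in> A'} \<inter> {v. v + y \<in> B'})"
      by (intro open_Int open_vimage_UNIV A' B' continuous_intros)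
    moreover have "0 \<in> {v. x + v \<in> A'} \<inter> {v. v + y \<in> B'}" using AB A' B' by simp
    ultimately obtain V where V: "compact V" "open V" "is_subgroup V"
        "V \<subseteq> {v. x + v \<in> A'} \<inter> {v. v + y \<in> B'}"
      using vd by meson
    obtain W where W: "open W" "0 \<in> W"
        and factor: "\<And>w. w \<in> W \<Longrightarrow> \<exists>b\<in>fwd (graph \<alpha>) V. \<exists>f\<in>fwd ((graph \<alpha>)\<inverse>) V. w = b + f"
      using back_factor[OF V(1-3)] by blast
    \<comment> \<open>The neighbourhood \<open>x + W + y\<close> of \<open>p\<close> is covered by
      the sums \<open>(x + b) + (f + y)\<close>. The factor order with
      \<open>fwd (graph \<alpha>) V\<close> first puts \<open>b\<close> next to \<open>x\<close> in
      \<open>par \<alpha>\<close> and \<open>f\<close> next to \<open>y\<close> in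
      \<open>par_minus \<alpha>\<close>.\<close>
    have "{t. - x + t - y \<in> W} \<subseteq> (\<lambda>(x, y). x + y) ` U"
    proof
      fix t assume "t \<in> {t. - x + t - y \<in> W}"
      then obtain b f where bf: "b \<in> fwd (graph \<alpha>) V" "f \<in> fwd ((graph \<alpha>)\<inverse>) V" "- x + t - y = b + f"
        using factor by blast
      have in_V: "b \<in> V" "f \<in> V" using bf(1,2) by (auto simp: fwd_def)
      have "b \<in> par \<alpha>" "f \<in> par_minus \<alpha>"
        using bf(1,2) fwd_subset_parab[OF V(1)] by (auto simp: par_eq_parab par_minus_eq_parab)
      then have "x + b \<in> A" "f + y \<in> B"
        using in_V V(4) AB(3,4) A'(2) B'(2) is_subgroupD(2)[OF par] is_subgroupD(2)[OF par_minus] by auto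
      then have "(x + b, f + y) \<in> U" using AB(5) by blast
      moreover have "t = (x + b) + (f + y)"
      proof -
        have "t = x + (- x + t - y) + y" by (simp add: add_diff_eq add.assoc[symmetric])
        then show ?thesis by (simp only: bf(3) add.assoc)
      qed
      ultimately show "t \<in> (\<lambda>(x, y). x + y) ` U" by (simp add: rev_image_eqI)
    qed
    moreover have "open {t. - x + t - y \<in> W}" by (intro open_vimage_UNIV W continuous_intros)
    moreover have "p \<in> {t. - x + t - y \<in> W}" using W(2) by (simp add: xy(2) add.assoc[symmetric])
    ultimately show "\<exists>T. open T \<and> p \<in> T \<and> T \<subseteq> (\<lambda>(x, y). x + y) ` U" by blast
  qed
  have "open (Omega \<alpha>)"
    unfolding image[symmetric]
    by (rule open_image) (metis openin_topspace topspace_prod_topology topspace_euclidean_subtopology)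
  moreover have "0 \<in> Omega \<alpha>"
    unfolding Omega using sumsetI[OF is_subgroupD(1)[OF par] is_subgroupD(1)[OF par_minus]] by simp
  moreover have "continuous_map (prod_topology (top_of_set (par \<alpha>)) (top_of_set (par_minus \<alpha>)))
      (top_of_set (Omega \<alpha>)) (\<lambda>(x, y). x + y)"
  proof -
    have "continuous_on (par \<alpha> \<times> par_minus \<alpha>) (\<lambda>(x, y). x + y)"
      unfolding case_prod_beta by (intro continuous_intros)
    then show ?thesis
      using image by (simp add: continuous_map_in_subtopology image_subset_iff_funcset[symmetric])
  qed
  moreover have "open_map (prod_topology (top_of_set (par \<alpha>)) (top_of_set (par_minus \<alpha>)))
      (top_of_set (Omega \<alpha>)) (\<lambda>(x, y). x + y)"
    unfolding open_map_def
  proof (intro allI impI)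
    fix U assume U: "openin (prod_topology (top_of_set (par \<alpha>)) (top_of_set (par_minus \<alpha>))) U"
    have "U \<subseteq> par \<alpha> \<times> par_minus \<alpha>" using openin_subset[OF U] by simp
    then have "(\<lambda>(x, y). x + y) ` U \<subseteq> Omega \<alpha>" unfolding image[symmetric] by (rule image_mono)
    then show "openin (top_of_set (Omega \<alpha>)) ((\<lambda>(x, y). x + y) ` U)"
      using open_image[OF U] by (rule open_subset)
  qed
  ultimately show ?thesis using invariant image by blast
qed

end
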